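(* Let $G$ be a finitely generated virtually nilpotent group, and let $N$ be a torsion-free nilpotent normal subgroup of finite index in $G$. Let $k\in\mathbb{N}$ and let $\varphi$ be an equation in $k$ variables over $G$. Then the set $$G_\varphi=\{(g_1,\ldots,g_k)\in G^k:\varphi(g_1,\ldots,g_k)=1\}$$ of solutions to $\varphi$ is the union of a set of cosets of $N^k$ in $G^k$ and a set that is negligible by finite quotients of $G^k$.
   Context: Write $F_k$ for the free group on generators $x_1,\ldots,x_k$. An equation in $k$ variables over a group $G$ is a word $\varphi\in F_k\ast G$ (free product). It is viewed as a function $G^k\to G$ by letting $\varphi(g_1,\ldots,g_k)$ be the element of $G$ obtained by replacing each instance of $x_i$ in $\varphi$ by $g_i$. A subset $V$ of a group $\Gamma$ is negligible by finite quotients of $\Gamma$ if for every $\varepsilon>0$ there exists a finite-index normal subgroup $K\lhd \Gamma$ such that $|VK/K|\le\varepsilon|\Gamma/K|$, where $VK/K$ denotes the image of $V$ in $\Gamma/K$. *)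

theory Defs
  imports Complex_Main "HOL-Algebra.Product_Groups"
begin

section \<open>Group-theoretic hypotheses\<close>

definition finitely_generated :: "('a, 'b) monoid_scheme \<Rightarrow> bool" where
  "finitely_generated G \<longleftrightarrow> (\<exists>S. finite S \<and> S \<subseteq> carrier G \<and> generate G S = carrier G)"

definition finite_index :: "'a set \<Rightarrow> ('a, 'b) monoid_scheme \<Rightarrow> bool" where
  "finite_index H G \<longleftrightarrow> subgroup H G \<and> finite (rcosets\<^bsub>G\<^esub> H)"

primrec lower_central_series :: "('a, 'b) monoid_scheme \<Rightarrow> nat \<Rightarrow> 'a set" where
  "lower_central_series G 0 = carrier G"
| "lower_central_series G (Suc n) =
     generate G {x \<otimes>\<^bsub>G\<^esub> y \<otimes>\<^bsub>G\<^esub> inv\<^bsub>G\<^esub> x \<otimes>\<^bsub>G\<^esub> inv\<^bsub>G\<^esub> y | x y.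
       x \<in> lower_central_series G n \<and> y \<in> carrier G}"

definition nilpotent_group :: "('a, 'b) monoid_scheme \<Rightarrow> bool" where
  "nilpotent_group G \<longleftrightarrow> group G \<and> (\<exists>n. lower_central_series G n = {\<one>\<^bsub>G\<^esub>})"

definition virtually_nilpotent :: "('a, 'b) monoid_scheme \<Rightarrow> bool" where
  "virtually_nilpotent G \<longleftrightarrow>
     (\<exists>H. finite_index H G \<and> nilpotent_group (G\<lparr>carrier := H\<rparr>))"

definition torsion_free :: "('a, 'b) monoid_scheme \<Rightarrow> bool" where
  "torsion_free G \<longleftrightarrow>
     (\<forall>x\<in>carrier G. \<forall>n::nat. 0 < n \<longrightarrow> x [^]\<^bsub>G\<^esub> n = \<one>\<^bsub>G\<^esub> \<longrightarrow> x = \<one>\<^bsub>G\<^esub>)"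

abbreviation power_group :: "('a, 'b) monoid_scheme \<Rightarrow> nat \<Rightarrow> (nat \<Rightarrow> 'a) monoid" where
  "power_group G k \<equiv> product_group {1..k} (\<lambda>_. G)"

section \<open>Sets negligible by finite quotients\<close>

definition negligible_by_finite_quotients :: "('a, 'b) monoid_scheme \<Rightarrow> 'a set \<Rightarrow> bool" where
  "negligible_by_finite_quotients \<Gamma> V \<longleftrightarrow>
     V \<subseteq> carrier \<Gamma> \<and>
     (\<forall>\<epsilon>::real. 0 < \<epsilon> \<longrightarrow>
        (\<exists>K. K \<lhd> \<Gamma> \<and> finite_index K \<Gamma> \<and>
             real (card ((\<lambda>v. K #>\<^bsub>\<Gamma>\<^esub> v) ` V)) \<le> \<epsilon> * real (order (\<Gamma> Mod K))))"

section \<open>The free product of a free group of rank k with a group\<close>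

text \<open>
  The free product of the free group on \<open>x\<^sub>1, \<dots>, x\<^sub>k\<close> with \<open>G\<close> is constructed as the set of
  words in the letters \<open>x\<^sub>i\<close>, \<open>x\<^sub>i\<close> inverse and the elements of \<open>G\<close>, modulo the congruence
  generated by free cancellation and by the multiplication table of \<open>G\<close>. That this is the
  free product is confirmed by its universal property, proved below
  (\<open>equation_group_universal\<close>).
\<close>

datatype 'a letter = Var nat | VarInv nat | Const 'a

definition words :: "('a, 'b) monoid_scheme \<Rightarrow> nat \<Rightarrow> 'a letter list set" where
  "words G k = lists (Var ` {1..k} \<union> VarInv ` {1..k} \<union> Const ` carrier G)"

inductive_set word_eq :: "('a, 'b) monoid_scheme \<Rightarrow> nat \<Rightarrow> ('a letter list \<times> 'a letter list) set"
  for G :: "('a, 'b) monoid_scheme" and k :: nat where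
  refl: "w \<in> words G k \<Longrightarrow> (w, w) \<in> word_eq G k"
| sym: "(v, w) \<in> word_eq G k \<Longrightarrow> (w, v) \<in> word_eq G k"
| trans: "(u, v) \<in> word_eq G k \<Longrightarrow> (v, w) \<in> word_eq G k \<Longrightarrow> (u, w) \<in> word_eq G k"
| cancel_right: "u \<in> words G k \<Longrightarrow> v \<in> words G k \<Longrightarrow> i \<in> {1..k} \<Longrightarrow>
    (u @ [Var i, VarInv i] @ v, u @ v) \<in> word_eq G k"
| cancel_left: "u \<in> words G k \<Longrightarrow> v \<in> words G k \<Longrightarrow> i \<in> {1..k} \<Longrightarrow>
    (u @ [VarInv i, Var i] @ v, u @ v) \<in> word_eq G k"
| const_one: "u \<in> words G k \<Longrightarrow> v \<in> words G k \<Longrightarrow>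
    (u @ [Const \<one>\<^bsub>G\<^esub>] @ v, u @ v) \<in> word_eq G k"
| const_mult: "u \<in> words G k \<Longrightarrow> v \<in> words G k \<Longrightarrow> a \<in> carrier G \<Longrightarrow> b \<in> carrier G \<Longrightarrow>
    (u @ [Const a, Const b] @ v, u @ [Const (a \<otimes>\<^bsub>G\<^esub> b)] @ v) \<in> word_eq G k"

definition equation_group :: "('a, 'b) monoid_scheme \<Rightarrow> nat \<Rightarrow> 'a letter list set monoid" where
  "equation_group G k =
     \<lparr>carrier = words G k // word_eq G k,
      monoid.mult = (\<lambda>A B. \<Union>u\<in>A. \<Union>v\<in>B. word_eq G k `` {u @ v}),
      one = word_eq G k `` {[]}\<rparr>"

text \<open>
  Substitution of \<open>g i\<close> for \<open>x\<^sub>i\<close> and of \<open>f a\<close> for the constant \<open>a\<close>, with the result in \<open>H\<close>.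
  Equations over \<open>G\<close> are evaluated with \<open>H = G\<close> and \<open>f\<close> the identity; the extra
  generality serves the universal property only.
\<close>

fun letter_value :: "('c, 'd) monoid_scheme \<Rightarrow> ('a \<Rightarrow> 'c) \<Rightarrow> (nat \<Rightarrow> 'c) \<Rightarrow> 'a letter \<Rightarrow> 'c" where
  "letter_value H f g (Var i) = g i"
| "letter_value H f g (VarInv i) = inv\<^bsub>H\<^esub> (g i)"
| "letter_value H f g (Const a) = f a"

primrec word_value ::
  "('c, 'd) monoid_scheme \<Rightarrow> ('a \<Rightarrow> 'c) \<Rightarrow> (nat \<Rightarrow> 'c) \<Rightarrow> 'a letter list \<Rightarrow> 'c" where
  "word_value H f g [] = \<one>\<^bsub>H\<^esub>"
| "word_value H f g (l # w) = letter_value H f g l \<otimes>\<^bsub>H\<^esub> word_value H f g w"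

text \<open>
  All words representing an equation have the same value (\<open>equation_value_eq\<close> below), so
  the image is a singleton.
\<close>

definition equation_value ::
  "('a, 'b) monoid_scheme \<Rightarrow> 'a letter list set \<Rightarrow> (nat \<Rightarrow> 'a) \<Rightarrow> 'a" where
  "equation_value G \<phi> g = the_elem (word_value G (\<lambda>a. a) g ` \<phi>)"

definition solutions :: "('a, 'b) monoid_scheme \<Rightarrow> nat \<Rightarrow> 'a letter list set \<Rightarrow> (nat \<Rightarrow> 'a) set" where
  "solutions G k \<phi> = {g \<in> carrier (power_group G k). equation_value G \<phi> g = \<one>\<^bsub>G\<^esub>}"

subsection \<open>Correctness of the construction\<close>

lemma words_Nil [simp]: "[] \<in> words G k"
  by (simp add: words_def)

lemma words_append [simp]: "u @ v \<in> words G k \<longleftrightarrow> u \<in> words G k \<and> v \<in> words G k"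
  by (auto simp: words_def)

lemma words_Cons: "l # w \<in> words G k \<longleftrightarrow> [l] \<in> words G k \<and> w \<in> words G k"
  by (auto simp: words_def)

lemma words_letter [simp]:
  "Var i # w \<in> words G k \<longleftrightarrow> i \<in> {1..k} \<and> w \<in> words G k"
  "VarInv i # w \<in> words G k \<longleftrightarrow> i \<in> {1..k} \<and> w \<in> words G k"
  "Const a # w \<in> words G k \<longleftrightarrow> a \<in> carrier G \<and> w \<in> words G k"
  by (auto simp: words_def)

context group
begin

lemma word_eq_words:
  assumes "(u, v) \<in> word_eq G k" shows "u \<in> words G k \<and> v \<in> words G k"
  using assms
  by (induction rule: word_eq.induct) auto

lemma equiv_word_eq: "equiv (words G k) (word_eq G k)"
  by (rule equivI)
    (auto simp: refl_on_def sym_def trans_def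
      dest: word_eq_words intro: word_eq.refl word_eq.sym word_eq.trans)

lemma word_eq_context:
  assumes "(u, v) \<in> word_eq G k" "p \<in> words G k" "q \<in> words G k"
  shows "(p @ u @ q, p @ v @ q) \<in> word_eq G k"
  using assms(1)
proof (induction rule: word_eq.induct)
  case (refl w)
  then show ?case using assms by (intro word_eq.refl) auto
next
  case (sym v w)
  then show ?case by (rule_tac word_eq.sym)
next
  case (trans u v w)
  then show ?case by (meson word_eq.trans)
next
  case (cancel_right u v i)
  then show ?case using word_eq.cancel_right[of "p @ u" G k "v @ q" i] assms by simp
next
  case (cancel_left u v i)
  then show ?case using word_eq.cancel_left[of "p @ u" G k "v @ q" i] assms by simp
next
  case (const_one u v)
  then show ?case using word_eq.const_one[of "p @ u" G k "v @ q"] assms by simp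
next
  case (const_mult u v a b)
  then show ?case using word_eq.const_mult[of "p @ u" G k "v @ q" a b] assms by simp
qed

lemma word_eq_append:
  assumes "(u, u') \<in> word_eq G k" "(v, v') \<in> word_eq G k"
  shows "(u @ v, u' @ v') \<in> word_eq G k"
proof -
  have "(u @ v, u' @ v) \<in> word_eq G k"
    using word_eq_context[OF assms(1), of "[]" v] word_eq_words[OF assms(2)] by simp
  moreover have "(u' @ v, u' @ v') \<in> word_eq G k"
    using word_eq_context[OF assms(2), of u' "[]"] word_eq_words[OF assms(1)] by simp
  ultimately show ?thesis by (rule word_eq.trans)
qed

lemma word_class_carrier [simp]:
  "w \<in> words G k \<Longrightarrow> word_eq G k `` {w} \<in> carrier (equation_group G k)"
  by (simp add: equation_group_def quotientI)

lemma equation_group_cases: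
  assumes "\<phi> \<in> carrier (equation_group G k)"
  obtains w where "w \<in> words G k" "\<phi> = word_eq G k `` {w}"
  using assms by (auto simp: equation_group_def elim: quotientE)

lemma word_class_mult:
  assumes "u \<in> words G k" "v \<in> words G k"
  shows "word_eq G k `` {u} \<otimes>\<^bsub>equation_group G k\<^esub> word_eq G k `` {v} = word_eq G k `` {u @ v}"
proof -
  have "word_eq G k `` {u' @ v'} = word_eq G k `` {u @ v}"
    if "(u, u') \<in> word_eq G k" "(v, v') \<in> word_eq G k" for u' v'
    using equiv_class_eq[OF equiv_word_eq word_eq_append[OF that]] by simp
  then have "(\<Union>u'\<in>word_eq G k `` {u}. \<Union>v'\<in>word_eq G k `` {v}. word_eq G k `` {u' @ v'})
      = (\<Union>u'\<in>word_eq G k `` {u}. \<Union>v'\<in>word_eq G k `` {v}. word_eq G k `` {u @ v})"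
    by (intro SUP_cong HOL.refl) simp
  moreover have "u \<in> word_eq G k `` {u}" "v \<in> word_eq G k `` {v}"
    using assms by (auto intro: word_eq.refl)
  then have "word_eq G k `` {u} \<noteq> {}" "word_eq G k `` {v} \<noteq> {}" by blast+
  ultimately show ?thesis
    by (simp add: equation_group_def)
qed

fun letter_inv :: "'a letter \<Rightarrow> 'a letter" where
  "letter_inv (Var i) = VarInv i"
| "letter_inv (VarInv i) = Var i"
| "letter_inv (Const a) = Const (inv a)"

lemma letter_inv_words [simp]: "[l] \<in> words G k \<Longrightarrow> [letter_inv l] \<in> words G k"
  by (cases l) (auto simp: words_def)

lemma letter_inv_cancel:
  assumes "[l] \<in> words G k" "u \<in> words G k" "v \<in> words G k"
  shows "(u @ [letter_inv l, l] @ v, u @ v) \<in> word_eq G k"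
proof (cases l)
  case (Const a)
  with assms have a: "a \<in> carrier G" by simp
  have "(u @ [Const (inv a), Const a] @ v, u @ [Const (inv a \<otimes> a)] @ v) \<in> word_eq G k"
    using assms a by (intro word_eq.const_mult) auto
  moreover have "(u @ [Const (inv a \<otimes> a)] @ v, u @ v) \<in> word_eq G k"
    using assms a word_eq.const_one[of u G k v] by simp
  ultimately show ?thesis using Const word_eq.trans by fastforce
qed (use assms word_eq.cancel_left[of u G k v] word_eq.cancel_right[of u G k v] in auto)

lemma word_left_inverse:
  assumes "w \<in> words G k"
  shows "\<exists>v\<in>words G k. (v @ w, []) \<in> word_eq G k"
  using assms
proof (induction w)
  case Nil
  then show ?case using word_eq.refl[of "[]" G k] by force
next
  case (Cons l w)
  then have l: "[l] \<in> words G k" and w: "w \<in> words G k" by (auto simp: words_Cons[of l w])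
  with Cons obtain v where v: "v \<in> words G k" "(v @ w, []) \<in> word_eq G k" by auto
  then have "((v @ [letter_inv l]) @ (l # w), []) \<in> word_eq G k"
    using letter_inv_cancel[OF l v(1) w] word_eq.trans by fastforce
  moreover have "v @ [letter_inv l] \<in> words G k" using v l by simp
  ultimately show ?case by blast
qed

lemma group_equation_group: "group (equation_group G k)"
proof (rule groupI)
  have one: "\<one>\<^bsub>equation_group G k\<^esub> = word_eq G k `` {[]}"
    by (simp add: equation_group_def)
  show "\<one>\<^bsub>equation_group G k\<^esub> \<in> carrier (equation_group G k)"
    by (simp add: one)
  fix x y z
  assume x: "x \<in> carrier (equation_group G k)"
  then obtain u where u: "u \<in> words G k" "x = word_eq G k `` {u}" by (rule equation_group_cases)
  show "\<one>\<^bsub>equation_group G k\<^esub> \<otimes>\<^bsub>equation_group G k\<^esub> x = x"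
    using u by (simp add: one word_class_mult)
  obtain v where "v \<in> words G k" "(v @ u, []) \<in> word_eq G k"
    using word_left_inverse[OF u(1)] by blast
  then have "word_eq G k `` {v} \<otimes>\<^bsub>equation_group G k\<^esub> x = \<one>\<^bsub>equation_group G k\<^esub>"
    using u equiv_class_eq[OF equiv_word_eq] by (simp add: word_class_mult one)
  then show "\<exists>y\<in>carrier (equation_group G k). y \<otimes>\<^bsub>equation_group G k\<^esub> x = \<one>\<^bsub>equation_group G k\<^esub>"
    using \<open>v \<in> words G k\<close> word_class_carrier by blast
  assume y: "y \<in> carrier (equation_group G k)"
  then obtain v where v: "v \<in> words G k" "y = word_eq G k `` {v}" by (rule equation_group_cases)
  show "x \<otimes>\<^bsub>equation_group G k\<^esub> y \<in> carrier (equation_group G k)"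
    using u v by (simp add: word_class_mult)
  assume z: "z \<in> carrier (equation_group G k)"
  then obtain w where w: "w \<in> words G k" "z = word_eq G k `` {w}" by (rule equation_group_cases)
  show "x \<otimes>\<^bsub>equation_group G k\<^esub> y \<otimes>\<^bsub>equation_group G k\<^esub> z =
        x \<otimes>\<^bsub>equation_group G k\<^esub> (y \<otimes>\<^bsub>equation_group G k\<^esub> z)"
    using u v w by (simp add: word_class_mult)
qed

end

lemma word_value_closed:
  assumes "group H" "f \<in> carrier G \<rightarrow> carrier H" "g \<in> {1..k} \<rightarrow> carrier H" "w \<in> words G k"
  shows "word_value H f g w \<in> carrier H"
proof -
  interpret H: group H by fact
  show ?thesis using assms(4)
  proof (induction w)
    case (Cons l w)
    have l: "[l] \<in> words G k" and w: "w \<in> words G k"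
      using Cons.prems words_Cons[of l w G k] by blast+
    have "letter_value H f g l \<in> carrier H"
      using l assms(2,3) by (cases l) (auto simp: Pi_iff)
    then show ?case using Cons.IH[OF w] by simp
  qed simp
qed

lemma word_value_append:
  assumes "group H" "f \<in> carrier G \<rightarrow> carrier H" "g \<in> {1..k} \<rightarrow> carrier H"
    "u \<in> words G k" "v \<in> words G k"
  shows "word_value H f g (u @ v) = word_value H f g u \<otimes>\<^bsub>H\<^esub> word_value H f g v"
proof -
  interpret H: group H by fact
  note closed = word_value_closed[OF assms(1-3)]
  show ?thesis using assms(4)
  proof (induction u)
    case Nil
    then show ?case using closed assms(5) by simp
  next
    case (Cons l u)
    have l: "[l] \<in> words G k" and u: "u \<in> words G k"
      using Cons.prems words_Cons[of l u G k] by blast+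
    moreover from l have "letter_value H f g l \<in> carrier H"
      using assms(2,3) by (cases l) (auto simp: Pi_iff)
    ultimately show ?case using Cons closed assms(5) by (simp add: H.m_assoc)
  qed
qed

lemma word_value_cong:
  assumes "group G" "group H" "f \<in> hom G H" "g \<in> {1..k} \<rightarrow> carrier H" "(u, v) \<in> word_eq G k"
  shows "word_value H f g u = word_value H f g v"
proof -
  interpret G: group G by fact
  interpret H: group H by fact
  have f: "f \<in> carrier G \<rightarrow> carrier H" using assms(3) by (simp add: hom_def)
  have f1: "f \<one>\<^bsub>G\<^esub> = \<one>\<^bsub>H\<^esub>" using assms(1-3) by (rule hom_one[rotated])
  note closed = word_value_closed[OF assms(2) f assms(4)]
  note append = word_value_append[OF assms(2) f assms(4)]
  have mid: "word_value H f g (p @ r @ q) = word_value H f g (p @ s @ q)"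
    if "p \<in> words G k" "q \<in> words G k" "r \<in> words G k" "s \<in> words G k"
      "word_value H f g r = word_value H f g s" for p q r s
    using that by (simp add: append)
  show ?thesis using assms(5)
  proof (induction rule: word_eq.induct)
    case (cancel_right u v i)
    moreover have "[Var i, VarInv i] \<in> words G k"
      using cancel_right by simp
    moreover have "g i \<in> carrier H" using assms(4) cancel_right by blast
    ultimately show ?case using mid[of u v "[Var i, VarInv i]" "[]"] by simp
  next
    case (cancel_left u v i)
    moreover have "[VarInv i, Var i] \<in> words G k"
      using cancel_left by simp
    moreover have "g i \<in> carrier H" using assms(4) cancel_left by blast
    ultimately show ?case using mid[of u v "[VarInv i, Var i]" "[]"] by simp
  next
    case (const_one u v)
    then show ?case using mid[of u v "[Const \<one>\<^bsub>G\<^esub>]" "[]"] f1 by simp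
  next
    case (const_mult u v a b)
    moreover have "[Const a, Const b] \<in> words G k"
      using const_mult by simp
    moreover have "f a \<in> carrier H" "f b \<in> carrier H" using f const_mult by auto
    ultimately show ?case
      using mid[of u v "[Const a, Const b]" "[Const (a \<otimes>\<^bsub>G\<^esub> b)]"] hom_mult[OF assms(3)] by simp
  qed simp_all
qed

lemma equation_value_eq:
  assumes "group G" "\<phi> \<in> carrier (equation_group G k)" "g \<in> carrier (power_group G k)" "w \<in> \<phi>"
  shows "equation_value G \<phi> g = word_value G (\<lambda>a. a) g w"
proof -
  interpret group G by fact
  have g: "g \<in> {1..k} \<rightarrow> carrier G" using assms(3) by (auto simp: PiE_iff)
  have f: "(\<lambda>a. a) \<in> hom G G" by (simp add: hom_def)
  obtain u where u: "\<phi> = word_eq G k `` {u}"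
    using assms(2) by (rule equation_group_cases)
  have "word_value G (\<lambda>a. a) g v = word_value G (\<lambda>a. a) g w" if "v \<in> \<phi>" for v
  proof -
    have "(u, v) \<in> word_eq G k" "(u, w) \<in> word_eq G k" using that assms(4) u by auto
    from word_value_cong[OF assms(1,1) f g this(1)] word_value_cong[OF assms(1,1) f g this(2)]
    show ?thesis by simp
  qed
  then have "word_value G (\<lambda>a. a) g ` \<phi> = (\<lambda>_. word_value G (\<lambda>a. a) g w) ` \<phi>"
    by (rule image_cong[OF HOL.refl])
  also have "\<dots> = {word_value G (\<lambda>a. a) g w}" by (rule image_constant[OF assms(4)])
  finally show ?thesis by (simp add: equation_value_def)
qed

text \<open>
  The canonical maps are \<open>a \<mapsto> [Const a]\<close>, a homomorphism, and \<open>x\<^sub>i \<mapsto> [Var i]\<close>.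
\<close>

lemma const_hom:
  assumes "group G"
  shows "(\<lambda>a. word_eq G k `` {[Const a]}) \<in> hom G (equation_group G k)"
proof -
  interpret group G by fact
  have "word_eq G k `` {[Const a, Const b]} = word_eq G k `` {[Const (a \<otimes>\<^bsub>G\<^esub> b)]}"
    if "a \<in> carrier G" "b \<in> carrier G" for a b
    using equiv_class_eq[OF equiv_word_eq] word_eq.const_mult[of "[]" G k "[]" a b] that by simp
  then show ?thesis by (intro homI) (auto simp: word_class_mult)
qed

theorem equation_group_universal:
  fixes G :: "('a, 'b) monoid_scheme" and H :: "('c, 'd) monoid_scheme"
  assumes "group G" "group H" "f \<in> hom G H" "g \<in> {1..k} \<rightarrow> carrier H"
  shows "\<exists>h \<in> hom (equation_group G k) H.
      (\<forall>a\<in>carrier G. h (word_eq G k `` {[Const a]}) = f a) \<and>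
      (\<forall>i\<in>{1..k}. h (word_eq G k `` {[Var i]}) = g i) \<and>
      (\<forall>h' \<in> hom (equation_group G k) H.
         (\<forall>a\<in>carrier G. h' (word_eq G k `` {[Const a]}) = f a) \<and>
         (\<forall>i\<in>{1..k}. h' (word_eq G k `` {[Var i]}) = g i) \<longrightarrow>
         (\<forall>\<phi> \<in> carrier (equation_group G k). h' \<phi> = h \<phi>))"
proof -
  interpret G: group G by fact
  interpret H: group H by fact
  interpret E: group "equation_group G k" by (rule G.group_equation_group)
  have f: "f \<in> carrier G \<rightarrow> carrier H" using assms(3) by (simp add: hom_def)
  note closed = word_value_closed[OF assms(2) f assms(4)]
  note append = word_value_append[OF assms(2) f assms(4)]
  define h where "h \<phi> = the_elem (word_value H f g ` \<phi>)" for \<phi>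
  have h: "h (word_eq G k `` {w}) = word_value H f g w" if "w \<in> words G k" for w
  proof -
    have "w \<in> word_eq G k `` {w}" using that by (simp add: word_eq.refl)
    have "word_value H f g v = word_value H f g w" if "v \<in> word_eq G k `` {w}" for v
      using that word_value_cong[OF assms, of w v] by simp
    then have "word_value H f g ` (word_eq G k `` {w})
        = (\<lambda>_. word_value H f g w) ` (word_eq G k `` {w})"
      by (rule image_cong[OF HOL.refl])
    also have "\<dots> = {word_value H f g w}" by (rule image_constant) fact
    finally have "word_value H f g ` (word_eq G k `` {w}) = {word_value H f g w}" .
    then show ?thesis by (simp add: h_def)
  qed
  have hom: "h \<in> hom (equation_group G k) H"
  proof (rule homI)
    fix x assume "x \<in> carrier (equation_group G k)"
    then obtain u where u: "u \<in> words G k" "x = word_eq G k `` {u}" by (rule G.equation_group_cases)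
    then show "h x \<in> carrier H" by (simp add: h closed)
    fix y assume "y \<in> carrier (equation_group G k)"
    then obtain v where "v \<in> words G k" "y = word_eq G k `` {v}" by (rule G.equation_group_cases)
    with u show "h (x \<otimes>\<^bsub>equation_group G k\<^esub> y) = h x \<otimes>\<^bsub>H\<^esub> h y"
      by (simp add: G.word_class_mult h append)
  qed
  have unique: "h' (word_eq G k `` {w}) = word_value H f g w"
    if h': "h' \<in> hom (equation_group G k) H"
      and c: "\<forall>a\<in>carrier G. h' (word_eq G k `` {[Const a]}) = f a"
      and x: "\<forall>i\<in>{1..k}. h' (word_eq G k `` {[Var i]}) = g i"
      and w: "w \<in> words G k" for h' w
    using w
  proof (induction w)
    case Nil
    have "word_eq G k `` {[]} = \<one>\<^bsub>equation_group G k\<^esub>" by (simp add: equation_group_def)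
    then show ?case using hom_one[OF h' E.group_axioms assms(2)] by simp
  next
    case (Cons l w)
    have l: "[l] \<in> words G k" and w: "w \<in> words G k"
      using Cons.prems words_Cons[of l w G k] by blast+
    have "h' (word_eq G k `` {[l]}) = letter_value H f g l"
    proof (cases l)
      case (VarInv i)
      then have i: "i \<in> {1..k}" using l by simp
      then have "word_eq G k `` {[VarInv i]} \<otimes>\<^bsub>equation_group G k\<^esub> word_eq G k `` {[Var i]}
          = word_eq G k `` {[]}"
        using equiv_class_eq[OF G.equiv_word_eq] word_eq.cancel_left[of "[]" G k "[]" i]
        by (simp add: G.word_class_mult)
      then have eq: "word_eq G k `` {[VarInv i]} = inv\<^bsub>equation_group G k\<^esub> (word_eq G k `` {[Var i]})"
        using i by (intro E.inv_equality[symmetric]) (auto simp: equation_group_def quotientI)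
      interpret h': group_hom "equation_group G k" H h'
        by unfold_locales (rule h')
      show ?thesis using VarInv x i by (simp add: eq)
    qed (use l c x in auto)
    moreover have "h' (word_eq G k `` {l # w})
        = h' (word_eq G k `` {[l]}) \<otimes>\<^bsub>H\<^esub> h' (word_eq G k `` {w})"
      using hom_mult[OF h', of "word_eq G k `` {[l]}" "word_eq G k `` {w}"] l w
      by (simp add: G.word_class_mult)
    ultimately show ?case using Cons.IH[OF w] by simp
  qed
  have "h (word_eq G k `` {[Const a]}) = f a" if "a \<in> carrier G" for a
    using that f by (auto simp: h Pi_iff)
  moreover have "h (word_eq G k `` {[Var i]}) = g i" if "i \<in> {1..k}" for i
  proof -
    have "g i \<in> carrier H" using assms(4) that by blast
    then show ?thesis using that by (simp add: h)
  qed
  moreover have "h' \<phi> = h \<phi>"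
    if h': "h' \<in> hom (equation_group G k) H"
      "\<forall>a\<in>carrier G. h' (word_eq G k `` {[Const a]}) = f a"
      "\<forall>i\<in>{1..k}. h' (word_eq G k `` {[Var i]}) = g i"
      "\<phi> \<in> carrier (equation_group G k)" for h' \<phi>
  proof -
    obtain w where "w \<in> words G k" "\<phi> = word_eq G k `` {w}"
      using h'(4) by (rule G.equation_group_cases)
    then show ?thesis using unique[OF h'(1-3)] h by simp
  qed
  ultimately show ?thesis using hom by blast
qed

end

theory Submission
  imports Defs "HOL-Computational_Algebra.Polynomial" "HOL-Computational_Algebra.Primes"
begin

text \<open>
  On a coset \<open>N\<^sup>k c\<close> an equation becomes a map from \<open>N\<^sup>k\<close> to \<open>G\<close>, and if it has a solution there,
  then it takes values in \<open>N\<close> and is a product of homomorphisms, their inverses and constants. By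
  the argument of Lazard and Leibman such a map \<open>f\<close> is polynomial: its iterated differences of
  high order are trivial. If \<open>f\<close> is not trivial, then after replacing \<open>f\<close> by a power of itself it
  takes values in a term of the lower central series of \<open>N\<close> and has a value of infinite order
  modulo the next term, which yields a nonzero integer-valued polynomial \<open>P\<close> on \<open>N\<^sup>k\<close> that vanishes
  wherever \<open>f\<close> is trivial.

  For a large prime \<open>p\<close>, the polynomials modulo \<open>p\<close> of bounded degree form a finite set, so they
  are invariant under a characteristic subgroup of \<open>N\<^sup>k\<close> of finite index, and in the quotient an
  analogue of the Schwartz-Zippel lemma shows that the proportion of zeros of \<open>P\<close> is \<open>O(1/p)\<close>.
\<close>

section \<open>The lower central series\<close>

text \<open>Negligibility counts the cosets that meet the solution set, and triviality of
  \<open>f\<close> at a point says little about its whole coset modulo a finite-index subgroup. An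
  integer-valued polynomial modulo \<open>p\<close> does descend to a finite quotient, which is why
  \<open>f\<close> is traded for \<open>P\<close>.

  The passage to a power of \<open>f\<close> cannot be avoided: a torsion-free nilpotent group such
  as the one generated by x, y and a central z with [x, y] = z^2 has torsion in its factors of the
  lower central series. So all values of \<open>f\<close> may have finite order modulo the next term
  although \<open>f\<close> is not trivial.

  The constants of the equation lie in \<open>G\<close> and not in \<open>N\<close>. They are moved
  to the left through the word and survive only as conjugations, which act on the normal subgroup
  \<open>N\<close> by automorphisms; this is where the homomorphisms come from.

  The degree of \<open>P\<close> does not depend on \<open>p\<close>, so a bound e^2 / p with fixed
  e suffices. Invariance under all polynomials of degree less than e, rather than under
  \<open>P\<close> alone, makes the subgroup characteristic and lets one subgroup serve every coset
  of N^k.\<close>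

definition commutator :: "('a, 'b) monoid_scheme \<Rightarrow> 'a \<Rightarrow> 'a \<Rightarrow> 'a" where
  "commutator G x y = x \<otimes>\<^bsub>G\<^esub> y \<otimes>\<^bsub>G\<^esub> inv\<^bsub>G\<^esub> x \<otimes>\<^bsub>G\<^esub> inv\<^bsub>G\<^esub> y"

declare lower_central_series.simps(2) [simp del]

context group
begin

lemma cancel_inv_left [simp]:
  assumes "x \<in> carrier G" "y \<in> carrier G"
  shows "x \<otimes> (inv x \<otimes> y) = y" "inv x \<otimes> (x \<otimes> y) = y"
  using assms by (simp_all flip: m_assoc)

lemmas word_simps = m_assoc inv_mult_group commutator_def

lemma commutator_closed [simp]:
  "x \<in> carrier G \<Longrightarrow> y \<in> carrier G \<Longrightarrow> commutator G x y \<in> carrier G"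
  by (simp add: commutator_def)

lemma normal_conj:
  assumes "H \<lhd> G" "x \<in> H" "g \<in> carrier G"
  shows "g \<otimes> x \<otimes> inv g \<in> H"
  using assms normal_inv_iff by blast

lemma lower_central_series_subset: "lower_central_series G n \<subseteq> carrier G"
proof (induction n)
  case (Suc n)
  then show ?case unfolding lower_central_series.simps by (intro generate_incl) auto
qed simp

lemma lower_central_series_normal: "lower_central_series G n \<lhd> G"
proof (induction n)
  case 0
  then show ?case by (simp add: normal_self)
next
  case (Suc n)
  let ?L = "lower_central_series G n"
  show ?case unfolding lower_central_series.simps
  proof (rule normal_generateI)
    show "{x \<otimes> y \<otimes> inv x \<otimes> inv y |x y. x \<in> ?L \<and> y \<in> carrier G} \<subseteq> carrier G"
      using lower_central_series_subset[of n] by auto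
    fix h g
    assume "h \<in> {x \<otimes> y \<otimes> inv x \<otimes> inv y |x y. x \<in> ?L \<and> y \<in> carrier G}" and g: "g \<in> carrier G"
    then obtain x y where h: "h = x \<otimes> y \<otimes> inv x \<otimes> inv y" and x: "x \<in> ?L" "x \<in> carrier G"
      and y: "y \<in> carrier G"
      using lower_central_series_subset[of n] by blast
    have "g \<otimes> h \<otimes> inv g = (g \<otimes> x \<otimes> inv g) \<otimes> (g \<otimes> y \<otimes> inv g)
        \<otimes> inv (g \<otimes> x \<otimes> inv g) \<otimes> inv (g \<otimes> y \<otimes> inv g)"
      using x y g by (simp add: h word_simps)
    moreover have "g \<otimes> x \<otimes> inv g \<in> ?L" using Suc x g by (intro normal_conj)
    ultimately show "g \<otimes> h \<otimes> inv g
        \<in> {x \<otimes> y \<otimes> inv x \<otimes> inv y |x y. x \<in> ?L \<and> y \<in> carrier G}"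
      using y g by blast
  qed
qed

lemma lower_central_series_commutator:
  "x \<in> lower_central_series G n \<Longrightarrow> y \<in> carrier G
    \<Longrightarrow> commutator G x y \<in> lower_central_series G (Suc n)"
  unfolding lower_central_series.simps commutator_def by (rule generate.incl) blast

lemma commutator_in_normal:
  assumes "H \<lhd> G" "x \<in> carrier G" "y \<in> carrier G" "x \<in> H \<or> y \<in> H"
  shows "commutator G x y \<in> H"
proof -
  interpret H: normal H G by fact
  have eq: "commutator G x y = x \<otimes> (y \<otimes> inv x \<otimes> inv y)" "commutator G x y = (x \<otimes> y \<otimes> inv x) \<otimes> inv y"
    using assms by (simp_all add: word_simps)
  show ?thesis
    using assms(4)
  proof
    assume "x \<in> H"
    then show ?thesis
      unfolding eq(1) using normal_conj[OF assms(1), of "inv x" y] assms by simp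
  next
    assume "y \<in> H"
    then show ?thesis
      unfolding eq(2) using normal_conj[OF assms(1), of y x] assms by simp
  qed
qed

lemma lower_central_series_Suc_subset:
  "lower_central_series G (Suc n) \<subseteq> lower_central_series G n"
proof -
  have "commutator G x y \<in> lower_central_series G n"
    if "x \<in> lower_central_series G n" "y \<in> carrier G" for x y
    using commutator_in_normal[OF lower_central_series_normal] that
      lower_central_series_subset[of n] by blast
  then show ?thesis
    unfolding lower_central_series.simps
    by (intro generate_subgroup_incl)
      (auto simp: commutator_def intro!: normal_imp_subgroup lower_central_series_normal)
qed

lemma hall_witt:
  assumes "a \<in> carrier G" "b \<in> carrier G" "c \<in> carrier G"
  shows "commutator G (commutator G a b) (b \<otimes> c \<otimes> inv b)
    \<otimes> commutator G (commutator G b c) (c \<otimes> a \<otimes> inv c)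
    \<otimes> commutator G (commutator G c a) (a \<otimes> b \<otimes> inv a) = \<one>"
  using assms by (simp add: word_simps)

lemma commutator_swap:
  "x \<in> carrier G \<Longrightarrow> y \<in> carrier G \<Longrightarrow> inv (commutator G x y) = commutator G y x"
  by (simp add: word_simps)

text \<open>The indices start at 0, hence the extra \<open>Suc\<close>. Induction on
  \<open>j\<close> by the argument of the three subgroups lemma: the Hall-Witt identity treats the
  generators [u, v] of the next term, and the formulas for [x, y z] and [x, inv y] extend this to
  the subgroup that they generate.\<close>

lemma lower_central_series_commutators:
  "x \<in> lower_central_series G i \<Longrightarrow> y \<in> lower_central_series G j
    \<Longrightarrow> commutator G x y \<in> lower_central_series G (Suc (i + j))"
proof (induction j arbitrary: i x y)
  case 0
  then show ?case using lower_central_series_commutator[of x i y] by simp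
next
  case (Suc j)
  let ?\<gamma> = "lower_central_series G"
  let ?L = "?\<gamma> (Suc (Suc (i + j)))"
  interpret L: normal ?L G by (rule lower_central_series_normal)
  have sub: "x \<in> carrier G" if "x \<in> ?\<gamma> n" for x n
    using that lower_central_series_subset by blast
  have gen: "commutator G x (commutator G u v) \<in> ?L"
    if x: "x \<in> ?\<gamma> i" and u: "u \<in> ?\<gamma> j" and v: "v \<in> carrier G" for x u v
  proof -
    \<comment> \<open>Chosen so that conjugating it by \<open>v\<close> gives back \<open>x\<close>;
      the first factor of the Hall-Witt identity for \<open>u\<close>, \<open>v\<close>,
      \<open>?c\<close> is then exactly [[u, v], x].\<close>
    let ?c = "inv v \<otimes> x \<otimes> v"
    note [simp] = sub[OF x] sub[OF u] v
    have c: "?c \<in> ?\<gamma> i"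
      using normal_conj[OF lower_central_series_normal x, of "inv v"] by simp
    interpret Li: normal "?\<gamma> (Suc i)" G by (rule lower_central_series_normal)
    have "commutator G v ?c = inv (commutator G ?c v)"
      by (rule commutator_swap[symmetric]) simp_all
    then have 1: "commutator G v ?c \<in> ?\<gamma> (Suc i)"
      using lower_central_series_commutator[OF c, of v] by simp
    have "?c \<otimes> u \<otimes> inv ?c \<in> ?\<gamma> j"
      by (rule normal_conj[OF lower_central_series_normal u]) simp
    from Suc.IH[OF 1 this] have 2: "commutator G (commutator G v ?c) (?c \<otimes> u \<otimes> inv ?c) \<in> ?L"
      by simp
    have 3: "commutator G (commutator G ?c u) (u \<otimes> v \<otimes> inv u) \<in> ?L"
      using lower_central_series_commutator[OF Suc.IH[OF c u]] by simp
    have "v \<otimes> ?c \<otimes> inv v = x" by (simp add: word_simps)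
    moreover have c': "?c \<in> carrier G" by simp
    ultimately have "commutator G (commutator G u v) x
        \<otimes> commutator G (commutator G v ?c) (?c \<otimes> u \<otimes> inv ?c)
        \<otimes> commutator G (commutator G ?c u) (u \<otimes> v \<otimes> inv u) = \<one>"
      using hall_witt[OF sub[OF u] v c'] by metis
    then have "commutator G (commutator G u v) x
        = inv (commutator G (commutator G v ?c) (?c \<otimes> u \<otimes> inv ?c)
        \<otimes> commutator G (commutator G ?c u) (u \<otimes> v \<otimes> inv u))"
      by (intro inv_equality[symmetric])
        (simp_all add: m_assoc del: cancel_inv_left inv_mult_group)
    then have "commutator G (commutator G u v) x \<in> ?L"
      using L.m_inv_closed[OF L.m_closed[OF 2 3]] by metis
    then have "inv (commutator G (commutator G u v) x) \<in> ?L" by (rule L.m_inv_closed)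
    then show ?thesis by (subst (asm) commutator_swap) simp_all
  qed
  have mult: "commutator G x (y \<otimes> z) = commutator G x y \<otimes> (y \<otimes> commutator G x z \<otimes> inv y)"
    if "x \<in> carrier G" "y \<in> carrier G" "z \<in> carrier G" for x y z
    using that by (simp add: word_simps)
  have inverse: "commutator G x (inv y) = inv y \<otimes> inv (commutator G x y) \<otimes> inv (inv y)"
    if "x \<in> carrier G" "y \<in> carrier G" for x y
    using that by (simp add: word_simps)
  let ?S = "{x \<otimes> y \<otimes> inv x \<otimes> inv y |x y. x \<in> ?\<gamma> j \<and> y \<in> carrier G}"
  have S: "?S \<subseteq> carrier G" using sub by auto
  have "y \<in> generate G ?S" using Suc.prems(2) by (simp only: lower_central_series.simps)
  then have "y \<in> carrier G \<and> commutator G x y \<in> ?L"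
  proof (induction y rule: generate.induct)
    case one
    then show ?case using sub[OF Suc.prems(1)] L.one_closed by (simp add: commutator_def)
  next
    case (incl h)
    then show ?case using gen[OF Suc.prems(1)] sub by (force simp: commutator_def)
  next
    case (inv h)
    then have "commutator G x h \<in> ?L" using gen[OF Suc.prems(1)] by (force simp: commutator_def)
    moreover have "h \<in> carrier G" using inv S by blast
    ultimately show ?case
      using inverse[OF sub[OF Suc.prems(1)]]
        normal_conj[OF lower_central_series_normal[of "Suc (Suc (i + j))"], of "inv (commutator G x h)" "inv h"]
      by simp
  next
    case (eng h1 h2)
    then show ?case
      using mult[OF sub[OF Suc.prems(1)]]
        normal_conj[OF lower_central_series_normal[of "Suc (Suc (i + j))"], of "commutator G x h2" h1]
      by simp
  qed
  then show ?case by simp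
qed

end

section \<open>Polynomial maps into filtered groups\<close>

text \<open>\<open>F\<close> is a filtration as in the work of Lazard. The domain carries none: a
  difference in any direction \<open>g\<close> counts as one step.\<close>

locale filtered_target = D: group D + A: group A
  for D :: "('d, 'x) monoid_scheme" and A :: "('a, 'y) monoid_scheme" +
  fixes F :: "nat \<Rightarrow> 'a set"
  assumes F_subgroup: "subgroup (F i) A"
    and F_Suc: "F (Suc i) \<subseteq> F i"
    and F_commutator: "x \<in> F i \<Longrightarrow> y \<in> F j \<Longrightarrow> commutator A x y \<in> F (i + j)"
begin

abbreviation difference :: "'d \<Rightarrow> ('d \<Rightarrow> 'a) \<Rightarrow> 'd \<Rightarrow> 'a" where
  "difference g f \<equiv> \<lambda>x. f (g \<otimes>\<^bsub>D\<^esub> x) \<otimes>\<^bsub>A\<^esub> inv\<^bsub>A\<^esub> (f x)"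

text \<open>Polynomial maps in the sense of Leibman, tested on \<open>m\<close>-fold differences only.\<close>

primrec poly_map :: "nat \<Rightarrow> nat \<Rightarrow> ('d \<Rightarrow> 'a) \<Rightarrow> bool" where
  "poly_map 0 i f \<longleftrightarrow> (\<forall>x\<in>carrier D. f x \<in> F i)"
| "poly_map (Suc m) i f \<longleftrightarrow>
     (\<forall>x\<in>carrier D. f x \<in> F i) \<and> (\<forall>g\<in>carrier D. poly_map m (Suc i) (difference g f))"

lemma F_carrier: "x \<in> F i \<Longrightarrow> x \<in> carrier A"
  by (rule subgroup.mem_carrier[OF F_subgroup])

lemma F_antimono: "i \<le> j \<Longrightarrow> F j \<subseteq> F i"
  by (rule lift_Suc_antimono_le[of F]) (rule F_Suc)

lemma poly_map_value: "poly_map m i f \<Longrightarrow> x \<in> carrier D \<Longrightarrow> f x \<in> F i"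
  by (cases m) auto

lemma poly_map_carrier [simp]: "poly_map m i f \<Longrightarrow> x \<in> carrier D \<Longrightarrow> f x \<in> carrier A"
  using poly_map_value F_carrier by blast

lemma poly_map_cong:
  assumes "poly_map m i f" "\<And>x. x \<in> carrier D \<Longrightarrow> f x = f' x"
  shows "poly_map m i f'"
  using assms
proof (induction m arbitrary: i f f')
  case (Suc m)
  have "poly_map m (Suc i) (difference g f')" if g: "g \<in> carrier D" for g
  proof (rule Suc.IH)
    show "poly_map m (Suc i) (difference g f)" using Suc.prems(1) g by simp
    show "difference g f x = difference g f' x" if "x \<in> carrier D" for x
      using Suc.prems(2) g that by simp
  qed
  moreover have "f' x \<in> F i" if "x \<in> carrier D" for x
    using Suc.prems that by fastforce
  ultimately show ?case by simp
qed auto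

lemma poly_map_Suc: "poly_map (Suc m) i f \<Longrightarrow> poly_map m i f"
proof (induction m arbitrary: i f)
  case (Suc m)
  have "poly_map m (Suc i) (difference g f)" if "g \<in> carrier D" for g
    by (rule Suc.IH) (use Suc.prems that in \<open>blast dest: poly_map.simps(2)[THEN iffD1]\<close>)
  then show ?case using poly_map.simps(2)[THEN iffD1, OF Suc.prems] by simp
qed auto

lemma poly_map_weaken: "poly_map m (Suc i) f \<Longrightarrow> poly_map m i f"
proof (induction m arbitrary: i f)
  case 0
  then show ?case using F_Suc by auto
next
  case (Suc m)
  then have "\<forall>x\<in>carrier D. f x \<in> F i" using F_Suc poly_map_value by blast
  moreover have "\<forall>g\<in>carrier D. poly_map m (Suc i) (difference g f)" using Suc by auto
  ultimately show ?case by simp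
qed

lemma poly_map_weaken_le:
  assumes "poly_map m j f" "i \<le> j" shows "poly_map m i f"
  using assms(2,1) by (induction rule: dec_induct) (auto intro: poly_map_weaken)

lemma poly_map_const: "a \<in> F i \<Longrightarrow> poly_map m i (\<lambda>_. a)"
proof (induction m arbitrary: i a)
  case (Suc m)
  have "a \<otimes>\<^bsub>A\<^esub> inv\<^bsub>A\<^esub> a \<in> F (Suc i)"
    using F_carrier[OF Suc.prems] subgroup.one_closed[OF F_subgroup] by simp
  then show ?case using Suc by simp
qed simp

text \<open>Products and commutators have to be treated simultaneously: the difference of a product
  involves a commutator of the factors, and the difference of a commutator is a product of
  commutators of maps with one derivative less to be tested.\<close>

lemma poly_map_closed:
  shows poly_map_mult:
      "poly_map m i f \<Longrightarrow> poly_map m i h \<Longrightarrow> poly_map m i (\<lambda>x. f x \<otimes>\<^bsub>A\<^esub> h x)"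
    and poly_map_inv: "poly_map m i f \<Longrightarrow> poly_map m i (\<lambda>x. inv\<^bsub>A\<^esub> (f x))"
    and poly_map_commutator:
      "poly_map m i f \<Longrightarrow> poly_map m j h \<Longrightarrow> poly_map m (i + j) (\<lambda>x. commutator A (f x) (h x))"
proof (induction m arbitrary: i j f h)
  case 0
  {
    case 1
    then show ?case using subgroup.m_closed[OF F_subgroup] by simp
  next
    case 2
    then show ?case using subgroup.m_inv_closed[OF F_subgroup] by simp
  next
    case 3
    then show ?case using F_commutator by simp
  }
next
  case (Suc m)
  note mult = Suc.IH(1) and inverse = Suc.IH(2)
  have commutator: "poly_map m l (\<lambda>x. commutator A (f x) (h x))"
    if "poly_map m i f" "poly_map m j h" "l \<le> i + j" for i j l f h
    using Suc.IH(3)[OF that(1,2)] that(3) by (rule poly_map_weaken_le)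
  \<comment> \<open>Conjugation is [f, h] h, and [f, h] lies at level i + j, so conjugating by any
    polynomial map keeps the level of \<open>h\<close>.\<close>
  have conj: "poly_map m j (\<lambda>x. f x \<otimes>\<^bsub>A\<^esub> h x \<otimes>\<^bsub>A\<^esub> inv\<^bsub>A\<^esub> (f x))"
    if f: "poly_map m i f" and h: "poly_map m j h" for i j f h
  proof (rule poly_map_cong[OF mult[OF commutator[OF f h, of j] h]])
    fix x assume "x \<in> carrier D"
    then have "f x \<in> carrier A" "h x \<in> carrier A" using f h by simp_all
    then show "commutator A (f x) (h x) \<otimes>\<^bsub>A\<^esub> h x = f x \<otimes>\<^bsub>A\<^esub> h x \<otimes>\<^bsub>A\<^esub> inv\<^bsub>A\<^esub> (f x)"
      by (simp add: A.word_simps)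
  qed simp
  have diff: "poly_map m (Suc i) (difference g f)" if "poly_map (Suc m) i f" "g \<in> carrier D" for i f g
    using that by simp
  {
    case 1
    have "poly_map m (Suc i) (difference g (\<lambda>x. f x \<otimes>\<^bsub>A\<^esub> h x))" if g: "g \<in> carrier D" for g
    proof (rule poly_map_cong[OF mult[OF diff[OF 1(1) g] conj[OF poly_map_Suc[OF 1(1)] diff[OF 1(2) g]]]])
      fix x assume x: "x \<in> carrier D"
      then have "f x \<in> carrier A" "h x \<in> carrier A"
        "f (g \<otimes>\<^bsub>D\<^esub> x) \<in> carrier A" "h (g \<otimes>\<^bsub>D\<^esub> x) \<in> carrier A"
        using 1 g by (blast intro: poly_map_carrier D.m_closed)+
      then show "difference g f x \<otimes>\<^bsub>A\<^esub> (f x \<otimes>\<^bsub>A\<^esub> difference g h x \<otimes>\<^bsub>A\<^esub> inv\<^bsub>A\<^esub> (f x))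
          = difference g (\<lambda>x. f x \<otimes>\<^bsub>A\<^esub> h x) x"
        by (simp add: A.word_simps)
    qed
    then show ?case using 1 poly_map_value subgroup.m_closed[OF F_subgroup] by simp
  next
    case 2
    have "poly_map m (Suc i) (difference g (\<lambda>x. inv\<^bsub>A\<^esub> (f x)))" if g: "g \<in> carrier D" for g
    proof (rule poly_map_cong[OF conj[OF inverse[OF poly_map_Suc[OF 2]] inverse[OF diff[OF 2 g]]]])
      fix x assume x: "x \<in> carrier D"
      then have "f x \<in> carrier A" "f (g \<otimes>\<^bsub>D\<^esub> x) \<in> carrier A"
        using 2 g by (blast intro: poly_map_carrier D.m_closed)+
      then show "inv\<^bsub>A\<^esub> (f x) \<otimes>\<^bsub>A\<^esub> inv\<^bsub>A\<^esub> (difference g f x) \<otimes>\<^bsub>A\<^esub> inv\<^bsub>A\<^esub> (inv\<^bsub>A\<^esub> (f x))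
          = difference g (\<lambda>x. inv\<^bsub>A\<^esub> (f x)) x"
        by (simp add: A.word_simps)
    qed
    then show ?case using 2 subgroup.m_inv_closed[OF F_subgroup] by simp
  next
    case 3
    let ?C = "\<lambda>x. commutator A (f x) (h x)"
    have "poly_map m (Suc (i + j)) (difference g ?C)" if g: "g \<in> carrier D" for g
    proof -
      \<comment> \<open>Substituting f (g x) = a f and h (g x) = b h, and writing C for [f, h], the
        difference of C becomes a [f, b] a^-1 times [a b, C] times the conjugate by C of [a, b] b
        [a, h] b^-1. Every commutator here has an entry that is a difference or a product of
        differences, which supplies the additional level.\<close>
      let ?a = "difference g f" and ?b = "difference g h"
      note f = poly_map_Suc[OF 3(1)] and h = poly_map_Suc[OF 3(2)]
      note a = diff[OF 3(1) g] and b = diff[OF 3(2) g]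
      have a0: "poly_map m 0 ?a" and b0: "poly_map m 0 ?b"
        by (rule poly_map_weaken_le[OF a] poly_map_weaken_le[OF b]; simp)+
      have C: "poly_map m (i + j) ?C" using commutator[OF f h] by simp
      have ab: "poly_map m 1 (\<lambda>x. ?a x \<otimes>\<^bsub>A\<^esub> ?b x)"
        by (rule mult[OF poly_map_weaken_le[OF a] poly_map_weaken_le[OF b]]) simp_all
      have 1: "poly_map m (Suc (i + j)) (\<lambda>x. ?a x \<otimes>\<^bsub>A\<^esub> commutator A (f x) (?b x) \<otimes>\<^bsub>A\<^esub> inv\<^bsub>A\<^esub> (?a x))"
        by (rule conj[OF a0 commutator[OF f b]]) simp
      have 2: "poly_map m (Suc (i + j)) (\<lambda>x. commutator A (?a x \<otimes>\<^bsub>A\<^esub> ?b x) (?C x))"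
        by (rule commutator[OF ab C]) simp
      have 3: "poly_map m (Suc (i + j)) (\<lambda>x. commutator A (?a x) (?b x))"
        by (rule commutator[OF a b]) simp
      have 4: "poly_map m (Suc (i + j)) (\<lambda>x. ?b x \<otimes>\<^bsub>A\<^esub> commutator A (?a x) (h x) \<otimes>\<^bsub>A\<^esub> inv\<^bsub>A\<^esub> (?b x))"
        by (rule conj[OF b0 commutator[OF a h]]) simp
      show ?thesis
      proof (rule poly_map_cong[OF mult[OF mult[OF 1 2] conj[OF C mult[OF 3 4]]]])
        fix x assume x: "x \<in> carrier D"
        then have "f x \<in> carrier A" "h x \<in> carrier A"
          "f (g \<otimes>\<^bsub>D\<^esub> x) \<in> carrier A" "h (g \<otimes>\<^bsub>D\<^esub> x) \<in> carrier A"
          using f h g by (blast intro: poly_map_carrier D.m_closed)+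
        then show "?a x \<otimes>\<^bsub>A\<^esub> commutator A (f x) (?b x) \<otimes>\<^bsub>A\<^esub> inv\<^bsub>A\<^esub> (?a x)
            \<otimes>\<^bsub>A\<^esub> commutator A (?a x \<otimes>\<^bsub>A\<^esub> ?b x) (?C x)
            \<otimes>\<^bsub>A\<^esub> (?C x \<otimes>\<^bsub>A\<^esub> (commutator A (?a x) (?b x)
              \<otimes>\<^bsub>A\<^esub> (?b x \<otimes>\<^bsub>A\<^esub> commutator A (?a x) (h x) \<otimes>\<^bsub>A\<^esub> inv\<^bsub>A\<^esub> (?b x)))
              \<otimes>\<^bsub>A\<^esub> inv\<^bsub>A\<^esub> (?C x))
            = difference g ?C x"
          by (simp add: A.word_simps)
      qed
    qed
    then show ?case using 3 F_commutator poly_map_value by simp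
  }
qed

text \<open>The difference of a homomorphism in direction \<open>g\<close> is the constant
  \<open>h g\<close>, which has to lie in \<open>F 1\<close>. This is why the filtration must begin
  with the whole group twice.\<close>

lemma poly_map_hom:
  assumes "h \<in> hom D A" "F 0 = carrier A" "F 1 = carrier A"
  shows "poly_map m 0 h"
proof (cases m)
  case 0
  then show ?thesis using assms by (auto simp: hom_def)
next
  case (Suc n)
  have "poly_map n 1 (difference g h)" if g: "g \<in> carrier D" for g
  proof (rule poly_map_cong[OF poly_map_const[of "h g" 1]])
    show "h g \<in> F 1" using assms g by (auto simp: hom_def)
    fix x assume x: "x \<in> carrier D"
    have "h g \<in> carrier A" "h x \<in> carrier A" using assms(1) g x by (auto simp: hom_def)
    then show "h g = difference g h x"
      using hom_mult[OF assms(1) g x] by (simp add: A.m_assoc)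
  qed
  then show ?thesis using Suc assms by (auto simp: hom_def)
qed

lemma poly_map_pow: "poly_map m i f \<Longrightarrow> poly_map m i (\<lambda>x. f x [^]\<^bsub>A\<^esub> (n::nat))"
proof (induction n)
  case 0
  then show ?case using poly_map_const[of "\<one>\<^bsub>A\<^esub>" i m] subgroup.one_closed[OF F_subgroup] by simp
next
  case (Suc n)
  then show ?case using poly_map_mult[OF Suc.IH Suc.prems] by simp
qed

end

section \<open>Zeros of integer sequences modulo a prime\<close>

definition forward_diff :: "(nat \<Rightarrow> int) \<Rightarrow> nat \<Rightarrow> int" where
  "forward_diff q = (\<lambda>n. q (Suc n) - q n)"

text \<open>The induction hypothesis is applied both to \<open>q\<close> and to
  \<open>forward_diff q\<close>, and Pascal's rule merges the two sums.\<close>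

lemma newton_forward_diff:
  "q n = (\<Sum>j\<le>n. int (n choose j) * (forward_diff ^^ j) q 0)"
proof (induction n arbitrary: q)
  case (Suc n)
  have "q (Suc n) = q n + forward_diff q n" by (simp add: forward_diff_def)
  also have "\<dots> = (\<Sum>j\<le>n. int (n choose j) * (forward_diff ^^ j) q 0)
      + (\<Sum>j\<le>n. int (n choose j) * (forward_diff ^^ Suc j) q 0)"
    using Suc.IH[of q] Suc.IH[of "forward_diff q"] by (simp only: funpow_Suc_right o_def)
  also have "(\<Sum>j\<le>n. int (n choose j) * (forward_diff ^^ j) q 0)
      = (\<Sum>j\<le>Suc n. int (n choose j) * (forward_diff ^^ j) q 0)" by simp
  also have "\<dots> = q 0 + (\<Sum>j\<le>n. int (n choose Suc j) * (forward_diff ^^ Suc j) q 0)"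
    by (subst sum.atMost_Suc_shift) simp
  also have "\<dots> + (\<Sum>j\<le>n. int (n choose j) * (forward_diff ^^ Suc j) q 0)
      = q 0 + (\<Sum>j\<le>n. int (Suc n choose Suc j) * (forward_diff ^^ Suc j) q 0)"
    by (simp add: sum.distrib[symmetric] algebra_simps del: funpow.simps)
  also have "\<dots> = (\<Sum>j\<le>Suc n. int (Suc n choose j) * (forward_diff ^^ j) q 0)"
    by (subst sum.atMost_Suc_shift) simp
  finally show ?case .
qed simp

lemma forward_diff_dvd_mono:
  assumes "\<And>n. p dvd (forward_diff ^^ e) q n" "e \<le> j"
  shows "p dvd (forward_diff ^^ j) q n"
  using assms(2,1)
proof (induction j arbitrary: n rule: dec_induct)
  case (step j)
  then show ?case by (simp add: forward_diff_def[of "(forward_diff ^^ j) q"])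
qed

text \<open>Lagrange's bound on roots modulo a prime, carried out with integer polynomials: after
  subtracting the constant \<open>poly R a\<close>, division by X - a is exact. The alternative
  \<open>R = 0\<close> is there because the zero polynomial has degree 0, so that a degree bound
  alone could never hold for empty \<open>A\<close>.\<close>

lemma poly_roots_mod:
  fixes R :: "int poly"
  assumes "prime p" "finite A" "A \<subseteq> {..<p}" "R = 0 \<or> degree R < card A"
    and "\<And>a. a \<in> A \<Longrightarrow> int p dvd poly R (int a)"
  shows "int p dvd poly R x"
  using assms(2-)
proof (induction A arbitrary: R x rule: finite_induct)
  case (insert a A)
  have "poly (R - [:poly R (int a):]) (int a) = 0" by simp
  then obtain S where S: "R - [:poly R (int a):] = [:- int a, 1:] * S"
    using poly_eq_0_iff_dvd dvdE by metis
  have eval: "poly R y = poly R (int a) + (y - int a) * poly S y" for y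
    using arg_cong[OF S, of "\<lambda>P. poly P y"] by (simp add: algebra_simps)
  have "S = 0 \<or> degree S < card A"
  proof (cases "S = 0")
    case False
    then have "degree ([:- int a, 1:] * S) = Suc (degree S)" by (subst degree_mult_eq) auto
    moreover have "degree (R - [:poly R (int a):]) \<le> degree R"
      by (rule degree_diff_le) auto
    ultimately have "Suc (degree S) \<le> degree R" by (simp only: S)
    then show ?thesis using insert by auto
  qed simp
  moreover have "int p dvd poly S (int b)" if b: "b \<in> A" for b
  proof -
    have "int p dvd (int b - int a) * poly S (int b)"
      using insert.prems(3)[of a] insert.prems(3)[of b] b eval[of "int b"]
      by (metis dvd_add_right_iff insertI1 insertI2)
    moreover have "\<not> int p dvd int b - int a"
    proof
      assume "int p dvd int b - int a"
      then have "int b mod int p = int a mod int p" by (simp add: mod_eq_dvd_iff)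
      moreover have "b < p" "a < p" using insert.prems(1) b by auto
      ultimately show False using insert.hyps(2) b by simp
    qed
    ultimately show ?thesis using \<open>prime p\<close> by (simp add: prime_dvd_mult_iff)
  qed
  ultimately have "int p dvd poly S x" using insert by auto
  then show ?case using eval[of x] insert.prems(3)[of a] by simp
qed simp

text \<open>Modulo \<open>p\<close> the Newton series stops before \<open>e\<close>. Multiplying by
  e! clears the denominators of the binomial coefficients and leaves an integer polynomial of degree
  less than \<open>e\<close>; since \<open>e < p\<close>, the factor e! is invertible modulo
  \<open>p\<close>.\<close>

lemma forward_diff_zeros_mod:
  fixes q :: "nat \<Rightarrow> int"
  assumes p: "prime p" and e: "e < p" and diff: "\<And>n. int p dvd (forward_diff ^^ e) q n"
    and A: "A \<subseteq> {..<p}" "e \<le> card A" "\<And>n. n \<in> A \<Longrightarrow> int p dvd q n"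
  shows "int p dvd q n"
proof -
  define R :: "int poly" where
    "R = (\<Sum>j<e. smult ((forward_diff ^^ j) q 0 * (fact e div fact j)) (\<Prod>i<j. [:- int i, 1:]))"
  have binom: "fact e * int (n choose j) = (fact e div fact j) * (\<Prod>i<j. int n - int i)"
    if "j < e" for n j
  proof -
    have "(fact j :: int) dvd fact e" using that by (simp add: fact_dvd)
    moreover have "fact j * int (n choose j) = (\<Prod>i<j. int n - int i)"
    proof -
      have "fact j * (of_nat (n choose j) :: rat) = (\<Prod>i = 0..<j. of_nat n - of_nat i)"
        by (simp add: binomial_gbinomial gbinomial_prod_rev)
      then have "rat_of_int (fact j * int (n choose j)) = rat_of_int (\<Prod>i<j. int n - int i)"
        by (simp add: lessThan_atLeast0)
      then show ?thesis by (simp only: of_int_eq_iff)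
    qed
    ultimately show ?thesis by (metis dvd_div_mult_self mult.assoc)
  qed
  have R: "int p dvd fact e * q n - poly R (int n)" for n
  proof -
    let ?t = "\<lambda>j. int (n choose j) * (forward_diff ^^ j) q 0"
    have "q n = (\<Sum>j\<le>n. ?t j)" by (rule newton_forward_diff)
    \<comment> \<open>Binomial coefficients with \<open>j > n\<close> vanish, so the sum may be
      extended to reach \<open>e\<close> even for small \<open>n\<close> and then be split
      there.\<close>
    also have "\<dots> = (\<Sum>j<max e (Suc n). ?t j)"
      by (rule sum.mono_neutral_left) auto
    also have "\<dots> = (\<Sum>j<e. ?t j) + (\<Sum>j=e..<max e (Suc n). ?t j)"
      unfolding lessThan_atLeast0 by (simp add: sum.atLeastLessThan_concat)
    finally have "q n = (\<Sum>j<e. ?t j) + (\<Sum>j=e..<max e (Suc n). ?t j)" .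
    moreover have "fact e * (\<Sum>j<e. ?t j) = poly R (int n)"
      unfolding R_def sum_distrib_left poly_sum
      by (rule sum.cong) (auto simp: poly_prod binom mult.assoc[symmetric] simp flip: binom)
    moreover have "int p dvd (\<Sum>j=e..<max e (Suc n). ?t j)"
      by (rule dvd_sum) (use forward_diff_dvd_mono[OF diff] in auto)
    ultimately show ?thesis by (simp add: distrib_left)
  qed
  have "R = 0 \<or> degree R < card A"
  proof (cases e)
    case 0
    then show ?thesis by (simp add: R_def)
  next
    case (Suc e')
    have "degree (\<Prod>i<j. [:- int i, 1:]) \<le> j" for j
      using degree_prod_sum_le[of "{..<j}" "\<lambda>i. [:- int i, 1:]"] by simp
    then have "degree (smult c (\<Prod>i<j. [:- int i, 1:])) \<le> e'" if "j < e" for c j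
      by (rule order.trans[OF degree_smult_le order.trans]) (use that Suc in simp)
    then have "degree R \<le> e'"
      unfolding R_def by (intro degree_sum_le) (simp_all del: degree_smult_eq)
    then show ?thesis using Suc A(2) by simp
  qed
  moreover have "finite A" using A(1) finite_subset by blast
  moreover have "int p dvd poly R (int a)" if "a \<in> A" for a
    using R[of a] A(3)[OF that] by (metis dvd_diff_right_iff dvd_mult)
  ultimately have "int p dvd poly R (int n)" using poly_roots_mod[OF p _ A(1)] by blast
  then have "int p dvd fact e * q n" using R[of n] by (simp add: dvd_diff_left_iff)
  moreover have "\<not> int p dvd fact e"
    using p e prime_dvd_fact_iff[of p e] by (metis int_dvd_int_iff not_le of_nat_fact)
  ultimately show ?thesis using p by (simp add: prime_dvd_mult_iff)
qed

section \<open>Integer-valued polynomials on groups\<close>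

context group
begin

text \<open>Polynomials of degree less than \<open>e\<close> modulo \<open>p\<close>; for \<open>p = 0\<close> nothing is reduced.\<close>

primrec int_poly :: "int \<Rightarrow> nat \<Rightarrow> ('a \<Rightarrow> int) \<Rightarrow> bool" where
  "int_poly p 0 Q \<longleftrightarrow> (\<forall>x\<in>carrier G. p dvd Q x)"
| "int_poly p (Suc e) Q \<longleftrightarrow> (\<forall>g\<in>carrier G. int_poly p e (\<lambda>x. Q (g \<otimes> x) - Q x))"

text \<open>For \<open>p = 0\<close> the hypothesis is equality on the carrier, so this also covers
  changes outside the carrier.\<close>

lemma int_poly_cong:
  assumes "int_poly p e Q" "\<And>x. x \<in> carrier G \<Longrightarrow> p dvd Q x - R x"
  shows "int_poly p e R"
  using assms
proof (induction e arbitrary: Q R)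
  case 0
  then show ?case by (metis dvd_diff_right_iff int_poly.simps(1))
next
  case (Suc e)
  have "int_poly p e (\<lambda>x. R (g \<otimes> x) - R x)" if g: "g \<in> carrier G" for g
  proof (rule Suc.IH)
    show "int_poly p e (\<lambda>x. Q (g \<otimes> x) - Q x)" using Suc.prems(1) g by simp
    fix x assume "x \<in> carrier G"
    then have "p dvd (Q (g \<otimes> x) - R (g \<otimes> x)) - (Q x - R x)"
      using dvd_diff[OF Suc.prems(2)[of "g \<otimes> x"] Suc.prems(2)[of x]] g by simp
    then show "p dvd Q (g \<otimes> x) - Q x - (R (g \<otimes> x) - R x)" by (simp add: algebra_simps)
  qed
  then show ?case by simp
qed

lemma int_poly_dvd: "int_poly p e Q \<Longrightarrow> q dvd p \<Longrightarrow> int_poly q e Q"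
  by (induction e arbitrary: Q) (auto intro: dvd_trans)

lemma int_poly_Suc: "int_poly p e Q \<Longrightarrow> int_poly p (Suc e) Q"
  by (induction e arbitrary: Q) (auto intro: dvd_diff)

lemma int_poly_mono: "e \<le> e' \<Longrightarrow> int_poly p e Q \<Longrightarrow> int_poly p e' Q"
  by (induction rule: dec_induct) (blast intro: int_poly_Suc)+

text \<open>The difference of Q o h in direction \<open>g\<close> is the difference of
  \<open>Q\<close> in direction \<open>h g\<close>, composed with \<open>h\<close>.\<close>

lemma int_poly_compose:
  assumes "h \<in> hom G G" "int_poly p e Q"
  shows "int_poly p e (\<lambda>x. Q (h x))"
  using assms(2)
proof (induction e arbitrary: Q)
  case 0
  then show ?case using assms(1) by (auto simp: hom_def)
next
  case (Suc e)
  have "int_poly p e (\<lambda>x. Q (h (g \<otimes> x)) - Q (h x))" if g: "g \<in> carrier G" for g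
  proof (rule int_poly_cong)
    have "h g \<in> carrier G" using assms(1) g by (auto simp: hom_def)
    then have "int_poly p e (\<lambda>x. Q (h g \<otimes> x) - Q x)" using Suc.prems by simp
    from Suc.IH[OF this] show "int_poly p e (\<lambda>x. Q (h g \<otimes> h x) - Q (h x))" .
  qed (use hom_mult[OF assms(1)] g in simp)
  then show ?case by simp
qed

text \<open>Translation by \<open>g\<close> turns a difference in direction \<open>h\<close> into
  one in the direction of its conjugate by \<open>g\<close>, and all directions are allowed.\<close>

lemma int_poly_translate:
  assumes "int_poly p e Q" "g \<in> carrier G"
  shows "int_poly p e (\<lambda>x. Q (g \<otimes> x))"
  using assms(1)
proof (induction e arbitrary: Q)
  case 0
  then show ?case using assms(2) by simp
next
  case (Suc e)
  have "int_poly p e (\<lambda>x. Q (g \<otimes> (h \<otimes> x)) - Q (g \<otimes> x))" if h: "h \<in> carrier G" for h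
  proof (rule int_poly_cong)
    have "int_poly p e (\<lambda>x. Q (g \<otimes> h \<otimes> inv g \<otimes> x) - Q x)" using Suc.prems assms(2) h by simp
    from Suc.IH[OF this] show "int_poly p e (\<lambda>x. Q (g \<otimes> h \<otimes> inv g \<otimes> (g \<otimes> x)) - Q (g \<otimes> x))" .
    show "p dvd Q (g \<otimes> h \<otimes> inv g \<otimes> (g \<otimes> x)) - Q (g \<otimes> x) - (Q (g \<otimes> (h \<otimes> x)) - Q (g \<otimes> x))"
      if "x \<in> carrier G" for x
    proof -
      have "g \<otimes> h \<otimes> inv g \<otimes> (g \<otimes> x) = g \<otimes> h \<otimes> (inv g \<otimes> g) \<otimes> x"
        using that h assms(2) by (simp only: m_assoc m_closed inv_closed)
      also have "\<dots> = g \<otimes> (h \<otimes> x)" using that h assms(2) by (simp add: m_assoc)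
      finally show ?thesis by simp
    qed
  qed
  then show ?case by simp
qed

text \<open>Restriction to the line g^n x reduces questions about zeros to integer sequences:
  forward differences of the sequence are group differences in the single direction
  \<open>g\<close>.\<close>

lemma int_poly_forward_diff:
  assumes "int_poly p e Q" "g \<in> carrier G" "x \<in> carrier G"
  shows "p dvd (forward_diff ^^ e) (\<lambda>n. Q (g [^] (n::nat) \<otimes> x)) n"
  using assms(1)
proof (induction e arbitrary: Q)
  case 0
  then show ?case using assms by simp
next
  case (Suc e)
  have "forward_diff (\<lambda>n. Q (g [^] (n::nat) \<otimes> x)) = (\<lambda>n. Q (g \<otimes> (g [^] n \<otimes> x)) - Q (g [^] n \<otimes> x))"
    unfolding forward_diff_def using assms(2,3) by (simp only: nat_pow_Suc2 m_assoc nat_pow_closed)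
  then show ?case
    using Suc.IH[of "\<lambda>x. Q (g \<otimes> x) - Q x"] Suc.prems assms(2) by (simp add: funpow_Suc_right del: funpow.simps)
qed

text \<open>A difference of \<open>Q\<close> that does not vanish modulo \<open>p\<close> has few zeros by induction, and where it
  does not vanish at \<open>x\<close>, the polynomial \<open>n \<mapsto> Q (g\<^sup>n x)\<close> is not constant, so that it has few
  zeros as well.\<close>

lemma int_poly_zeros_bound:
  assumes "K \<lhd> G" "finite (rcosets K)" and p: "prime p" and e: "e < p"
    and Q: "int_poly (int p) e Q" "\<And>k x. k \<in> K \<Longrightarrow> x \<in> carrier G \<Longrightarrow> int p dvd Q (k \<otimes> x) - Q x"
    and nonzero: "x0 \<in> carrier G" "\<not> int p dvd Q x0"
  shows "p * card {C \<in> rcosets K. \<forall>x\<in>C. int p dvd Q x} \<le> e\<^sup>2 * card (rcosets K)"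
  using e Q nonzero
proof (induction e arbitrary: Q x0)
  case 0
  then show ?case by auto
next
  case (Suc e)
  interpret K: normal K G by fact
  interpret quot: group "G Mod K" by (rule K.factorgroup_is_group)
  let ?X = "rcosets K"
  let ?Z = "\<lambda>Q. {C \<in> ?X. \<forall>x\<in>C. int p dvd Q x}"
  have carrier_quot: "carrier (G Mod K) = ?X" by (simp add: FactGroup_def)
  have zero_iff: "K #> x \<in> ?Z Q \<longleftrightarrow> int p dvd Q x"
    if Q: "\<And>k x. k \<in> K \<Longrightarrow> x \<in> carrier G \<Longrightarrow> int p dvd Q (k \<otimes> x) - Q x" and x: "x \<in> carrier G" for Q x
  proof
    show "int p dvd Q x" if "K #> x \<in> ?Z Q" using that rcos_self[OF x K.is_subgroup] by blast
    assume "int p dvd Q x"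
    then have "int p dvd Q (k \<otimes> x)" if "k \<in> K" for k
      using Q[OF that x] by (simp add: dvd_diff_left_iff)
    then show "K #> x \<in> ?Z Q"
      using x by (auto simp: r_coset_def RCOSETS_def)
  qed
  show ?case
  proof (cases "\<exists>g\<in>carrier G. \<exists>x\<in>carrier G. \<not> int p dvd Q (g \<otimes> x) - Q x")
    \<comment> \<open>All differences vanish modulo \<open>p\<close>, so \<open>Q\<close> is a
      constant modulo \<open>p\<close>, namely its nonzero value at \<open>x0\<close>.\<close>
    case False
    have "\<not> int p dvd Q x" if x: "x \<in> carrier G" for x
    proof -
      have "int p dvd Q ((x0 \<otimes> inv x) \<otimes> x) - Q x" using False Suc.prems x by blast
      then show ?thesis using Suc.prems(4,5) x by (auto simp: m_assoc dvd_diff_left_iff)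
    qed
    then have empty: "?Z Q = {}" using zero_iff[OF Suc.prems(3)] by (fastforce simp: RCOSETS_def)
    show ?thesis unfolding empty by simp
  next
    case True
    then obtain g x1 where g: "g \<in> carrier G" and x1: "x1 \<in> carrier G" "\<not> int p dvd Q (g \<otimes> x1) - Q x1"
      by blast
    let ?D = "\<lambda>x. Q (g \<otimes> x) - Q x"
    \<comment> \<open>Here normality of \<open>K\<close> enters: g k x is the translate of g x by a
      conjugate of k.\<close>
    have D_inv: "int p dvd ?D (k \<otimes> x) - ?D x" if k: "k \<in> K" and x: "x \<in> carrier G" for k x
    proof -
      have "g \<otimes> k \<otimes> inv g \<in> K" using K.inv_op_closed2 g k by blast
      moreover have "(g \<otimes> k \<otimes> inv g) \<otimes> (g \<otimes> x) = g \<otimes> (k \<otimes> x)"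
        using g x K.mem_carrier[OF k] by (simp add: m_assoc inv_solve_left)
      ultimately have "int p dvd Q (g \<otimes> (k \<otimes> x)) - Q (g \<otimes> x)"
        using Suc.prems(3)[of "g \<otimes> k \<otimes> inv g" "g \<otimes> x"] g x by simp
      from dvd_diff[OF this Suc.prems(3)[OF k x]] show ?thesis by (simp add: algebra_simps)
    qed
    have IH: "p * card (?Z ?D) \<le> e\<^sup>2 * card ?X"
      by (rule Suc.IH[OF _ _ D_inv x1]) (use Suc.prems g in auto)
    \<comment> \<open>The pairs (n, C) with n < p for which \<open>T n C\<close> is a coset of zeros
      are counted twice: for fixed \<open>n\<close> the map \<open>T n\<close> permutes the cosets,
      and for fixed \<open>C\<close> the index \<open>n\<close> runs along a line.\<close>
    define T where "T n C = (K #> g [^] n) <#> C" for n :: nat and C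
    have T: "T n (K #> x) = K #> (g [^] n \<otimes> x)" if "x \<in> carrier G" for n x
      using g that by (simp add: T_def K.rcos_sum)
    have card_T: "card {C \<in> ?X. T n C \<in> ?Z Q} = card (?Z Q)" for n
    proof -
      let ?a = "K #> g [^] n"
      have a: "?a \<in> carrier (G Mod K)" using g by (auto simp: carrier_quot RCOSETS_def)
      have T': "T n C = ?a \<otimes>\<^bsub>G Mod K\<^esub> C" for C by (simp add: T_def FactGroup_def)
      have cancel: "inv\<^bsub>G Mod K\<^esub> ?a \<otimes>\<^bsub>G Mod K\<^esub> T n C = C" "T n (inv\<^bsub>G Mod K\<^esub> ?a \<otimes>\<^bsub>G Mod K\<^esub> C) = C"
        "inv\<^bsub>G Mod K\<^esub> ?a \<otimes>\<^bsub>G Mod K\<^esub> C \<in> ?X" if "C \<in> ?X" for C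
        using that a unfolding T' carrier_quot[symmetric]
        by (simp_all only: quot.cancel_inv_left quot.m_closed quot.inv_closed)
      have "bij_betw (T n) {C \<in> ?X. T n C \<in> ?Z Q} (?Z Q)"
        by (rule bij_betw_byWitness[where f' = "\<lambda>C. inv\<^bsub>G Mod K\<^esub> ?a \<otimes>\<^bsub>G Mod K\<^esub> C"])
          (use cancel in \<open>auto simp del: mult_FactGroup\<close>)
      then show ?thesis by (rule bij_betw_same_card)
    qed
    have line: "card {n \<in> {..<p}. T n C \<in> ?Z Q} \<le> e" if C: "C \<in> ?X" "C \<notin> ?Z ?D" for C
    proof (rule ccontr)
      obtain x where x: "x \<in> carrier G" "C = K #> x" using C(1) by (auto simp: RCOSETS_def)
      let ?q = "\<lambda>n::nat. Q (g [^] n \<otimes> x)"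
      let ?A = "{n \<in> {..<p}. T n C \<in> ?Z Q}"
      \<comment> \<open>More than \<open>e\<close> zeros are the \<open>Suc e\<close> zeros that
        force the whole sequence to vanish modulo \<open>p\<close>; its terms 0 and 1 then make
        \<open>?D x\<close> vanish, against the choice of \<open>C\<close>.\<close>
      assume "\<not> card ?A \<le> e"
      moreover have "int p dvd ?q n" if "n \<in> ?A" for n
        using that zero_iff[OF Suc.prems(3), of "g [^] n \<otimes> x"] T x g by simp
      ultimately have "int p dvd ?q n" for n
        using forward_diff_zeros_mod[OF p Suc.prems(1) int_poly_forward_diff[OF Suc.prems(2) g x(1)], of ?A]
        by auto
      from this[of 1] this[of 0] have "int p dvd ?D x" using g x by (simp add: dvd_diff)
      then show False using zero_iff[OF D_inv, of x] x C by blast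
    qed
    have "p * card (?Z Q) = (\<Sum>n<p. card {C \<in> ?X. T n C \<in> ?Z Q})" unfolding card_T by simp
    also have "\<dots> = (\<Sum>C\<in>?X. card {n \<in> {..<p}. T n C \<in> ?Z Q})"
      using sum.swap_restrict[of "{..<p}" ?X "\<lambda>_ _. 1::nat" "\<lambda>n C. T n C \<in> ?Z Q"] assms(2) by simp
    also have "\<dots> \<le> (\<Sum>C\<in>?X. (if C \<in> ?Z ?D then p else 0) + e)"
    proof (rule sum_mono)
      fix C assume "C \<in> ?X"
      moreover have "card {n \<in> {..<p}. T n C \<in> ?Z Q} \<le> card {..<p}" by (rule card_mono) auto
      ultimately show "card {n \<in> {..<p}. T n C \<in> ?Z Q} \<le> (if C \<in> ?Z ?D then p else 0) + e"
        using line[of C] by auto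
    qed
    also have "\<dots> = p * card (?Z ?D) + e * card ?X"
      using assms(2) by (simp add: sum.distrib sum.If_cases Int_def)
    also have "\<dots> \<le> e\<^sup>2 * card ?X + e * card ?X" using IH by simp
    \<comment> \<open>The recursion adds \<open>e\<close> at each degree, which would give e (e - 1)
      / 2; the square is a simpler upper bound.\<close>
    also have "\<dots> \<le> (Suc e)\<^sup>2 * card ?X" by (simp add: power2_eq_square algebra_simps)
    finally show ?thesis .
  qed
qed

section \<open>Finitely many polynomials modulo p, and their common stabilizer\<close>

lemma difference_dvd_generate:
  assumes "S \<subseteq> carrier G" "generate G S = carrier G"
    and "\<And>s x. s \<in> S \<Longrightarrow> x \<in> carrier G \<Longrightarrow> p dvd Q (s \<otimes> x) - Q x"
    and "t \<in> carrier G" "x \<in> carrier G"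
  shows "(p::int) dvd Q (t \<otimes> x) - Q x"
proof -
  have "t \<in> generate G S" using assms by simp
  then show ?thesis
    using assms(5)
  proof (induction t arbitrary: x rule: generate.induct)
    case (inv s)
    then have "s \<in> carrier G" using assms(1) by blast
    then have "p dvd Q x - Q (inv s \<otimes> x)"
      using assms(3)[OF inv(1), of "inv s \<otimes> x"] inv(2) by (simp add: m_assoc[symmetric])
    then show ?case by (simp add: dvd_diff_commute)
  next
    case (eng t u)
    have "t \<in> carrier G" "u \<in> carrier G" using eng assms(1) generate_in_carrier by blast+
    then have "p dvd (Q (t \<otimes> (u \<otimes> x)) - Q (u \<otimes> x)) + (Q (u \<otimes> x) - Q x)"
      using eng by (intro dvd_add) auto
    then show ?case using \<open>t \<in> carrier G\<close> \<open>u \<in> carrier G\<close> eng by (simp add: m_assoc)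
  qed (use assms in auto)
qed

text \<open>Reduced values and extensionality leave one function per residue class. Such a function
  is determined by its value at the identity and by its differences along the finitely many
  generators, which are polynomials of smaller degree; \<open>?\<Phi>\<close> records these
  data.\<close>

lemma finite_int_poly:
  assumes "finite S" "S \<subseteq> carrier G" "generate G S = carrier G" "0 < p"
  shows "finite {Q \<in> carrier G \<rightarrow>\<^sub>E {0..<p}. int_poly p e Q}"
proof (induction e)
  case 0
  have "{Q \<in> carrier G \<rightarrow>\<^sub>E {0..<p}. int_poly p 0 Q} \<subseteq> carrier G \<rightarrow>\<^sub>E {0}"
  proof
    fix Q assume "Q \<in> {Q \<in> carrier G \<rightarrow>\<^sub>E {0..<p}. int_poly p 0 Q}"
    then have "Q \<in> extensional (carrier G)" and Q: "\<And>x. x \<in> carrier G \<Longrightarrow> 0 \<le> Q x \<and> Q x < p \<and> p dvd Q x"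
      by (auto simp: PiE_iff)
    moreover have "Q x = 0" if "x \<in> carrier G" for x
      using Q[OF that] zdvd_not_zless[of "Q x" p] by linarith
    ultimately show "Q \<in> carrier G \<rightarrow>\<^sub>E {0}" unfolding PiE_iff by blast
  qed
  moreover have "carrier G \<rightarrow>\<^sub>E {0::int} = {\<lambda>x\<in>carrier G. 0}" by (auto simp: PiE_iff fun_eq_iff extensional_def)
  ultimately show ?case by (metis finite.emptyI finite.insertI finite_subset)
next
  case (Suc e)
  let ?P = "\<lambda>e. {Q \<in> carrier G \<rightarrow>\<^sub>E {0..<p}. int_poly p e Q}"
  let ?\<Phi> = "\<lambda>Q. (Q \<one>, \<lambda>s\<in>S. \<lambda>x\<in>carrier G. (Q (s \<otimes> x) - Q x) mod p)"
  show ?case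
  proof (rule inj_on_finite[of ?\<Phi> _ "{0..<p} \<times> (S \<rightarrow>\<^sub>E ?P e)"])
    show "finite ({0..<p} \<times> (S \<rightarrow>\<^sub>E ?P e))" using Suc assms(1) by (intro finite_cartesian_product finite_PiE) auto
    show "?\<Phi> ` ?P (Suc e) \<subseteq> {0..<p} \<times> (S \<rightarrow>\<^sub>E ?P e)"
    proof (rule image_subsetI)
      fix Q assume Q: "Q \<in> ?P (Suc e)"
      have "int_poly p e (\<lambda>x\<in>carrier G. (Q (s \<otimes> x) - Q x) mod p)" if "s \<in> S" for s
      proof (rule int_poly_cong)
        show "int_poly p e (\<lambda>x. Q (s \<otimes> x) - Q x)" using Q that assms(2) by auto
      qed (simp add: minus_mod_eq_mult_div)
      then show "?\<Phi> Q \<in> {0..<p} \<times> (S \<rightarrow>\<^sub>E ?P e)" using Q assms(4) by (auto simp: PiE_iff)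
    qed
    show "inj_on ?\<Phi> (?P (Suc e))"
    proof (rule inj_onI)
      fix Q R assume Q: "Q \<in> ?P (Suc e)" and R: "R \<in> ?P (Suc e)" and eq: "?\<Phi> Q = ?\<Phi> R"
      have step: "p dvd (Q (s \<otimes> x) - R (s \<otimes> x)) - (Q x - R x)" if "s \<in> S" "x \<in> carrier G" for s x
      proof -
        have "(\<lambda>s\<in>S. \<lambda>x\<in>carrier G. (Q (s \<otimes> x) - Q x) mod p) s x
            = (\<lambda>s\<in>S. \<lambda>x\<in>carrier G. (R (s \<otimes> x) - R x) mod p) s x" using eq by simp
        then have "p dvd (Q (s \<otimes> x) - Q x) - (R (s \<otimes> x) - R x)"
          using that by (simp add: mod_eq_dvd_iff)
        then show ?thesis by (simp add: algebra_simps)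
      qed
      show "Q = R"
      proof (rule extensionalityI[of Q "carrier G" R])
        show "Q \<in> extensional (carrier G)" "R \<in> extensional (carrier G)"
          using Q R by (auto simp: PiE_iff)
        fix x assume x: "x \<in> carrier G"
        have "p dvd (Q (x \<otimes> \<one>) - R (x \<otimes> \<one>)) - (Q \<one> - R \<one>)"
          by (rule difference_dvd_generate[of S p "\<lambda>x. Q x - R x"]) (use assms step x in auto)
        then have "p dvd Q x - R x" using eq x by simp
        then have "Q x mod p = R x mod p" by (simp add: mod_eq_dvd_iff)
        moreover have "Q x \<in> {0..<p}" "R x \<in> {0..<p}" using Q R x by (auto simp: PiE_iff)
        ultimately show "Q x = R x" by simp
      qed
    qed
  qed
qed

text \<open>Quantifying over all \<open>Q\<close> makes the subgroup invariant under automorphisms,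
  since composing with an automorphism permutes the polynomials. The stabilizer of a single
  \<open>Q\<close> would not have this property in general.\<close>

definition int_poly_stabilizer :: "int \<Rightarrow> nat \<Rightarrow> 'a set" where
  "int_poly_stabilizer p e =
     {k \<in> carrier G. \<forall>Q. int_poly p e Q \<longrightarrow> (\<forall>x\<in>carrier G. p dvd Q (k \<otimes> x) - Q x)}"

lemma int_poly_stabilizerD:
  "k \<in> int_poly_stabilizer p e \<Longrightarrow> int_poly p e Q \<Longrightarrow> x \<in> carrier G \<Longrightarrow> p dvd Q (k \<otimes> x) - Q x"
  by (simp add: int_poly_stabilizer_def)

lemma subgroup_int_poly_stabilizer: "subgroup (int_poly_stabilizer p e) G"
proof (rule subgroupI)
  show "int_poly_stabilizer p e \<subseteq> carrier G" by (auto simp: int_poly_stabilizer_def)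
  have "\<one> \<in> int_poly_stabilizer p e" by (auto simp: int_poly_stabilizer_def)
  then show "int_poly_stabilizer p e \<noteq> {}" by blast
  fix a assume a: "a \<in> int_poly_stabilizer p e"
  then have ac: "a \<in> carrier G" by (simp add: int_poly_stabilizer_def)
  have "p dvd Q (inv a \<otimes> x) - Q x" if "int_poly p e Q" "x \<in> carrier G" for Q x
    using int_poly_stabilizerD[OF a that(1), of "inv a \<otimes> x"] that(2) ac
    by (simp add: m_assoc[symmetric] dvd_diff_commute)
  then show "inv a \<in> int_poly_stabilizer p e" using ac by (simp add: int_poly_stabilizer_def)
  fix b assume b: "b \<in> int_poly_stabilizer p e"
  then have bc: "b \<in> carrier G" by (simp add: int_poly_stabilizer_def)
  have "p dvd Q (a \<otimes> b \<otimes> x) - Q x" if "int_poly p e Q" "x \<in> carrier G" for Q x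
    using dvd_add[OF int_poly_stabilizerD[OF a that(1), of "b \<otimes> x"] int_poly_stabilizerD[OF b that]] that(2) ac bc
    by (simp add: m_assoc)
  then show "a \<otimes> b \<in> int_poly_stabilizer p e" using ac bc by (simp add: int_poly_stabilizer_def)
qed

lemma int_poly_stabilizer_iso:
  assumes "h \<in> iso G G" "k \<in> int_poly_stabilizer p e"
  shows "h k \<in> int_poly_stabilizer p e"
proof -
  have h: "h \<in> hom G G" and surj: "h ` carrier G = carrier G"
    using assms(1) by (auto simp: iso_def bij_betw_def)
  have k: "k \<in> carrier G" using assms(2) by (simp add: int_poly_stabilizer_def)
  have "p dvd Q (h k \<otimes> y) - Q y" if Q: "int_poly p e Q" and y: "y \<in> carrier G" for Q y
  proof -
    obtain x where x: "x \<in> carrier G" "y = h x" using surj y by blast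
    show ?thesis
      using int_poly_stabilizerD[OF assms(2) int_poly_compose[OF h Q] x(1)] hom_mult[OF h k x(1)] x(2) by simp
  qed
  moreover have "h k \<in> carrier G" using h k by (auto simp: hom_def)
  ultimately show ?thesis by (simp add: int_poly_stabilizer_def)
qed

text \<open>Left translations act on the finite set \<open>?P\<close> of reduced polynomials, and
  elements acting in the same way lie in the same coset. So the cosets are indexed by finitely many
  self-maps of \<open>?P\<close>.\<close>

lemma finite_rcosets_int_poly_stabilizer:
  assumes "finite S" "S \<subseteq> carrier G" "generate G S = carrier G" "0 < p"
  shows "finite (rcosets (int_poly_stabilizer p e))"
proof -
  let ?K = "int_poly_stabilizer p e"
  let ?P = "{Q \<in> carrier G \<rightarrow>\<^sub>E {0..<p}. int_poly p e Q}"
  define \<Psi> where "\<Psi> k = (\<lambda>Q\<in>?P. \<lambda>x\<in>carrier G. Q (k \<otimes> x))" for k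
  have "\<Psi> k \<in> ?P \<rightarrow>\<^sub>E ?P" if k: "k \<in> carrier G" for k
  proof -
    have "(\<lambda>x\<in>carrier G. Q (k \<otimes> x)) \<in> ?P" if Q: "Q \<in> ?P" for Q
    proof -
      have "int_poly p e (\<lambda>x\<in>carrier G. Q (k \<otimes> x))"
        by (rule int_poly_cong[OF int_poly_translate[OF _ k, of p e Q]]) (use Q in auto)
      then show ?thesis using Q k by (auto simp: PiE_iff)
    qed
    then show ?thesis by (auto simp: \<Psi>_def)
  qed
  then have "\<Psi> ` carrier G \<subseteq> ?P \<rightarrow>\<^sub>E ?P" by blast
  then have finite_image: "finite (\<Psi> ` carrier G)"
    by (rule finite_subset) (intro finite_PiE finite_int_poly[OF assms])
  have fibre: "?K #> k = ?K #> l" if k: "k \<in> carrier G" and l: "l \<in> carrier G" and eq: "\<Psi> k = \<Psi> l" for k l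
  proof -
    have "p dvd Q (k \<otimes> inv l \<otimes> x) - Q x" if Q: "int_poly p e Q" and x: "x \<in> carrier G" for Q x
    proof -
      \<comment> \<open>The stabilizer speaks of all integer-valued \<open>Q\<close>, while
        \<open>\<Psi>\<close> sees only reduced ones.\<close>
      let ?Q = "\<lambda>x\<in>carrier G. Q x mod p"
      have "int_poly p e ?Q"
        by (rule int_poly_cong[OF Q]) (simp add: minus_mod_eq_mult_div)
      then have "?Q \<in> ?P" using assms(4) by auto
      then have "\<Psi> k ?Q (inv l \<otimes> x) = ?Q (k \<otimes> (inv l \<otimes> x))" "\<Psi> l ?Q (inv l \<otimes> x) = ?Q (l \<otimes> (inv l \<otimes> x))"
        using l x by (simp_all add: \<Psi>_def)
      then have "?Q (k \<otimes> (inv l \<otimes> x)) = ?Q (l \<otimes> (inv l \<otimes> x))" using eq by simp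
      then have "Q (k \<otimes> inv l \<otimes> x) mod p = Q (l \<otimes> inv l \<otimes> x) mod p" using k l x by (simp add: m_assoc)
      then show ?thesis using l x by (simp add: mod_eq_dvd_iff)
    qed
    then have "k \<otimes> inv l \<in> ?K" using k l by (simp add: int_poly_stabilizer_def)
    moreover have "k = k \<otimes> inv l \<otimes> l" using k l by (simp add: m_assoc)
    ultimately have "k \<in> ?K #> l" unfolding r_coset_def by blast
    then show ?thesis using repr_independence[OF _ l subgroup_int_poly_stabilizer] by simp
  qed
  have "rcosets ?K = (\<lambda>\<psi>. ?K #> (SOME k. k \<in> carrier G \<and> \<Psi> k = \<psi>)) ` (\<Psi> ` carrier G)"
  proof -
    have "?K #> (SOME l. l \<in> carrier G \<and> \<Psi> l = \<Psi> k) = ?K #> k" if "k \<in> carrier G" for k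
    proof -
      have "(SOME l. l \<in> carrier G \<and> \<Psi> l = \<Psi> k) \<in> carrier G \<and> \<Psi> (SOME l. l \<in> carrier G \<and> \<Psi> l = \<Psi> k) = \<Psi> k"
        by (rule someI[of _ k]) (use that in simp)
      then show ?thesis using fibre that by blast
    qed
    then show ?thesis by (auto simp: RCOSETS_def image_iff)
  qed
  then show ?thesis using finite_image by simp
qed

end

section \<open>Polynomial maps into abelian groups\<close>

text \<open>\<open>H\<close> comes from Zorn's lemma. If \<open>b\<close> is not in
  \<open>H\<close>, then by maximality the subgroup generated by \<open>H\<close> and
  \<open>b\<close> contains a positive power of \<open>a\<close>, and this relation is solved for a
  power of \<open>b\<close>. The result does the work of a homomorphism to the rationals that is
  nonzero at \<open>a\<close>.\<close>

lemma (in comm_group) exists_maximal_disjoint_subgroup: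
  assumes a: "a \<in> carrier G" and inf: "\<And>n::nat. 0 < n \<Longrightarrow> a [^] n \<noteq> \<one>"
  obtains H where "subgroup H G" "\<And>n::nat. 0 < n \<Longrightarrow> a [^] n \<notin> H"
    "\<And>b. b \<in> carrier G \<Longrightarrow> \<exists>n>0::nat. \<exists>i::int. \<exists>h\<in>H. b [^] n = a [^] i \<otimes> h"
proof -
  let ?\<F> = "{H. subgroup H G \<and> (\<forall>n::nat. 0 < n \<longrightarrow> a [^] n \<notin> H)}"
  have "\<exists>M\<in>?\<F>. \<forall>X\<in>?\<F>. M \<subseteq> X \<longrightarrow> X = M"
  proof (rule subset_Zorn_nonempty)
    show "?\<F> \<noteq> {}" using inf triv_subgroup by blast
    fix \<C> assume ne: "\<C> \<noteq> {}" and chain: "subset.chain ?\<F> \<C>"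
    then have sub: "H \<in> \<C> \<Longrightarrow> subgroup H G" for H by (auto simp: subset.chain_def)
    have "subgroup (\<Union>\<C>) G"
    proof (rule subgroupI)
      show "\<Union>\<C> \<subseteq> carrier G" using subgroup.subset[OF sub] by blast
      show "\<Union>\<C> \<noteq> {}" using ne subgroup.one_closed[OF sub] by blast
      show "inv x \<in> \<Union>\<C>" if "x \<in> \<Union>\<C>" for x
        using that subgroup.m_inv_closed[OF sub] by blast
      fix x y assume "x \<in> \<Union>\<C>" "y \<in> \<Union>\<C>"
      then obtain H K where HK: "H \<in> \<C>" "x \<in> H" "K \<in> \<C>" "y \<in> K" by blast
      then have "H \<subseteq> K \<or> K \<subseteq> H" using chain by (auto simp: subset.chain_def)
      then show "x \<otimes> y \<in> \<Union>\<C>"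
      proof
        assume "H \<subseteq> K"
        then have "x \<otimes> y \<in> K" using subgroup.m_closed[OF sub[OF HK(3)]] HK by blast
        then show ?thesis using HK by blast
      next
        assume "K \<subseteq> H"
        then have "x \<otimes> y \<in> H" using subgroup.m_closed[OF sub[OF HK(1)]] HK by blast
        then show ?thesis using HK by blast
      qed
    qed
    moreover have "a [^] n \<notin> H" if "H \<in> \<C>" "0 < n" for H and n :: nat
      using chain that by (auto simp: subset.chain_def)
    ultimately show "\<Union>\<C> \<in> ?\<F>" by auto
  qed
  then obtain H where HF: "H \<in> ?\<F>" and max: "\<forall>X\<in>?\<F>. H \<subseteq> X \<longrightarrow> X = H" by (rule bexE)
  have H: "subgroup H G" "\<And>n::nat. 0 < n \<Longrightarrow> a [^] n \<notin> H" using HF by simp_all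
  interpret H: subgroup H G by fact
  show thesis
  proof (rule that[OF H])
    fix b assume b: "b \<in> carrier G"
    let ?B = "{b [^] i \<otimes> h | (i::int) h. h \<in> H}"
    have B: "subgroup ?B G"
    proof (rule subgroupI)
      show "?B \<subseteq> carrier G" using b by auto
      show "?B \<noteq> {}" using H.one_closed by blast
      fix x assume "x \<in> ?B"
      then obtain i h where x: "x = b [^] (i::int) \<otimes> h" "h \<in> H" by blast
      have "inv x = b [^] (- i) \<otimes> inv h" using x b by (simp add: inv_mult int_pow_neg)
      then show "inv x \<in> ?B" using x by blast
      fix y assume "y \<in> ?B"
      then obtain j h' where y: "y = b [^] (j::int) \<otimes> h'" "h' \<in> H" by blast
      have "x \<otimes> y = b [^] (i + j) \<otimes> (h \<otimes> h')" using x y b by (simp add: int_pow_mult m_ac)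
      then show "x \<otimes> y \<in> ?B" using x y by blast
    qed
    have HB: "H \<subseteq> ?B"
    proof
      fix h assume h: "h \<in> H"
      then have "h = b [^] (0::int) \<otimes> h" by simp
      then show "h \<in> ?B" using h by blast
    qed
    have "b = b [^] (1::int) \<otimes> \<one>" using b by (simp add: int_pow_1)
    then have bB: "b \<in> ?B" using H.one_closed by blast
    show "\<exists>n>0::nat. \<exists>i::int. \<exists>h\<in>H. b [^] n = a [^] i \<otimes> h"
    proof (cases "?B \<in> ?\<F>")
      case True
      have "?B = H" using bspec[OF max True] HB by (rule mp)
      then have "b \<in> H" using bB by (rule subst)
      moreover have "b [^] (1::nat) = a [^] (0::int) \<otimes> b" using b by simp
      ultimately show ?thesis using zero_less_one by blast
    next
      case False
      then obtain k where k: "0 < k" "a [^] (k::nat) \<in> ?B" using B by blast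
      then obtain i h where ih: "a [^] k = b [^] (i::int) \<otimes> h" "h \<in> H" by blast
      have hc: "h \<in> carrier G" using ih by simp
      have bi: "b [^] i = a [^] (int k) \<otimes> inv h"
        using ih(1) a b hc by (simp add: int_pow_int m_assoc)
      \<comment> \<open>The sign decides whether the relation has to be inverted to make the
        exponent of \<open>b\<close> positive; exponent 0 would put a positive power of
        \<open>a\<close> into \<open>H\<close>.\<close>
      consider "0 < i" | "i < 0" | "i = 0" by linarith
      then show ?thesis
      proof cases
        case 1
        then have "b [^] nat i = a [^] (int k) \<otimes> inv h"
          using bi by (metis int_pow_int int_nat_eq order_less_imp_le)
        then show ?thesis using 1 ih(2) H.m_inv_closed by (metis zero_less_nat_eq)
      next
        case 2
        have "b [^] (- i) = a [^] (- int k) \<otimes> h"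
          using bi a b hc by (simp add: int_pow_neg inv_mult del: int_pow_int)
        moreover have "b [^] nat (- i) = b [^] (- i)"
          using 2 int_pow_int[of G b "nat (- i)"] by simp
        ultimately show ?thesis using 2 ih(2) by (metis neg_0_less_iff_less zero_less_nat_eq)
      next
        case 3
        then have "a [^] k \<in> H" using ih b hc by simp
        then show ?thesis using H(2) k(1) by blast
      qed
    qed
  qed
qed

locale abelian_target = D: group D + A: comm_group A
  for D :: "('d, 'x) monoid_scheme" and A :: "('a, 'y) monoid_scheme"
begin

abbreviation difference :: "'d \<Rightarrow> ('d \<Rightarrow> 'a) \<Rightarrow> 'd \<Rightarrow> 'a" where
  "difference g f \<equiv> \<lambda>x. f (g \<otimes>\<^bsub>D\<^esub> x) \<otimes>\<^bsub>A\<^esub> inv\<^bsub>A\<^esub> (f x)"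

text \<open>The set \<open>B\<close> is a parameter because exponents are bounded both modulo the
  trivial subgroup and modulo the product of \<open>H\<close> with the powers of
  \<open>a\<close>.\<close>

primrec poly_mod :: "'a set \<Rightarrow> nat \<Rightarrow> ('d \<Rightarrow> 'a) \<Rightarrow> bool" where
  "poly_mod B 0 f \<longleftrightarrow> (\<forall>x\<in>carrier D. f x \<in> B)"
| "poly_mod B (Suc m) f \<longleftrightarrow> (\<forall>g\<in>carrier D. poly_mod B m (difference g f))"

lemma poly_mod_mono: "poly_mod B m f \<Longrightarrow> B \<subseteq> C \<Longrightarrow> poly_mod C m f"
  by (induction m arbitrary: f) auto

lemma poly_mod_cong:
  assumes "poly_mod B m f" "\<And>x. x \<in> carrier D \<Longrightarrow> f x = h x"
  shows "poly_mod B m h"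
  using assms
proof (induction m arbitrary: f h)
  case (Suc m)
  have "poly_mod B m (difference g h)" if g: "g \<in> carrier D" for g
  proof (rule Suc.IH)
    show "poly_mod B m (difference g f)" using Suc.prems(1) g by simp
  qed (use Suc.prems(2) g in simp)
  then show ?case by simp
qed simp

lemma difference_in_generate:
  assumes "S \<subseteq> carrier D" "generate D S = carrier D" "subgroup E A" "f \<in> carrier D \<rightarrow> carrier A"
    and "\<And>s x. s \<in> S \<Longrightarrow> x \<in> carrier D \<Longrightarrow> difference s f x \<in> E"
    and "t \<in> carrier D" "x \<in> carrier D"
  shows "difference t f x \<in> E"
proof -
  interpret E: subgroup E A by fact
  have f: "f y \<in> carrier A" if "y \<in> carrier D" for y using assms(4) that by blast
  have "t \<in> generate D S" using assms by simp
  then show ?thesis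
    using assms(7)
  proof (induction t arbitrary: x rule: generate.induct)
    case one
    then show ?case using f by simp
  next
    case (incl s)
    then show ?case using assms(5) by blast
  next
    case (inv s)
    then have s: "s \<in> carrier D" using assms(1) by blast
    have "inv\<^bsub>A\<^esub> (difference s f (inv\<^bsub>D\<^esub> s \<otimes>\<^bsub>D\<^esub> x)) \<in> E"
      using assms(5)[OF inv(1), of "inv\<^bsub>D\<^esub> s \<otimes>\<^bsub>D\<^esub> x"] inv(2) s by blast
    then show ?case using f s inv(2) by (simp add: A.inv_mult A.m_comm)
  next
    case (eng t u)
    have tu: "t \<in> carrier D" "u \<in> carrier D" using eng assms(1) D.generate_in_carrier by blast+
    have "difference t f (u \<otimes>\<^bsub>D\<^esub> x) \<otimes>\<^bsub>A\<^esub> difference u f x \<in> E"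
      by (rule E.m_closed[OF eng.IH(1)[OF D.m_closed[OF tu(2) eng.prems]] eng.IH(2)[OF eng.prems]])
    then show ?case using f tu eng.prems by (simp add: A.m_assoc D.m_assoc)
  qed
qed

lemma torsion_subgroup:
  assumes "subgroup B A" shows "subgroup {a \<in> carrier A. a [^]\<^bsub>A\<^esub> (n::nat) \<in> B} A"
proof -
  interpret B: subgroup B A by fact
  show ?thesis
    by (rule A.subgroupI) (auto simp: A.nat_pow_inv A.nat_pow_distrib)
qed

text \<open>The exponents given for single points could be unbounded. By induction on the degree the
  differences along each of the finitely many generators have a uniform exponent, and every value of
  \<open>f\<close> is the value at the identity times a product of such differences and their
  inverses.\<close>

lemma bounded_exponent:
  assumes S: "finite S" "S \<subseteq> carrier D" "generate D S = carrier D" and B: "subgroup B A"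
    and f: "f \<in> carrier D \<rightarrow> carrier A" "poly_mod B m f"
      "\<And>x. x \<in> carrier D \<Longrightarrow> \<exists>n>0::nat. f x [^]\<^bsub>A\<^esub> n \<in> B"
  shows "\<exists>n>0::nat. \<forall>x\<in>carrier D. f x [^]\<^bsub>A\<^esub> n \<in> B"
  using f
proof (induction m arbitrary: f)
  case 0
  then have "\<forall>x\<in>carrier D. f x [^]\<^bsub>A\<^esub> (1::nat) \<in> B"
    by (simp add: Pi_iff)
  then show ?case by (metis zero_less_one)
next
  case (Suc m)
  interpret B: subgroup B A by fact
  have fc: "f y \<in> carrier A" if "y \<in> carrier D" for y using Suc.prems(1) that by blast
  have mult: "a [^]\<^bsub>A\<^esub> (k * l) \<in> B" if "a \<in> carrier A" "a [^]\<^bsub>A\<^esub> k \<in> B" for a and k l :: nat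
  proof -
    have "(a [^]\<^bsub>A\<^esub> k) [^]\<^bsub>A\<^esub> l \<in> B" using that(2) by (induction l) auto
    then show ?thesis using that(1) by (simp add: A.nat_pow_pow)
  qed
  have "\<exists>n>0::nat. \<forall>x\<in>carrier D. difference s f x [^]\<^bsub>A\<^esub> n \<in> B" if s: "s \<in> S" for s
  proof (rule Suc.IH)
    have sc: "s \<in> carrier D" using S s by blast
    then show "difference s f \<in> carrier D \<rightarrow> carrier A" "poly_mod B m (difference s f)"
      using fc Suc.prems(2) by auto
    fix x assume x: "x \<in> carrier D"
    obtain k l where kl: "0 < (k::nat)" "f (s \<otimes>\<^bsub>D\<^esub> x) [^]\<^bsub>A\<^esub> k \<in> B" "0 < (l::nat)" "f x [^]\<^bsub>A\<^esub> l \<in> B"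
      using Suc.prems(3) x sc by (meson D.m_closed)
    have "f (s \<otimes>\<^bsub>D\<^esub> x) [^]\<^bsub>A\<^esub> (k * l) \<in> B" "f x [^]\<^bsub>A\<^esub> (k * l) \<in> B"
      using mult[OF _ kl(2), of l] mult[OF _ kl(4), of k] fc x sc by (simp_all add: mult.commute)
    then have "difference s f x [^]\<^bsub>A\<^esub> (k * l) \<in> B"
      using subgroup.m_closed[OF torsion_subgroup[OF B, of "k * l"] _ subgroup.m_inv_closed[OF torsion_subgroup[OF B, of "k * l"]]]
        fc x sc by simp
    then show "\<exists>n>0::nat. difference s f x [^]\<^bsub>A\<^esub> n \<in> B" using kl by (metis nat_0_less_mult_iff)
  qed
  then have "\<exists>\<nu>. \<forall>s\<in>S. 0 < \<nu> s \<and> (\<forall>x\<in>carrier D. difference s f x [^]\<^bsub>A\<^esub> (\<nu> s :: nat) \<in> B)"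
    by (intro bchoice) blast
  then obtain \<nu> where \<nu>: "\<And>s. s \<in> S \<Longrightarrow> 0 < \<nu> s"
    "\<And>s x. s \<in> S \<Longrightarrow> x \<in> carrier D \<Longrightarrow> difference s f x [^]\<^bsub>A\<^esub> (\<nu> s :: nat) \<in> B"
    by blast
  obtain n1 where n1: "0 < (n1::nat)" "f \<one>\<^bsub>D\<^esub> [^]\<^bsub>A\<^esub> n1 \<in> B" using Suc.prems(3) by blast
  \<comment> \<open>A common multiple of the exponent at the identity and of the exponents for all
    generators.\<close>
  let ?n = "n1 * prod \<nu> S"
  let ?E = "{a \<in> carrier A. a [^]\<^bsub>A\<^esub> ?n \<in> B}"
  have E: "subgroup ?E A" by (rule torsion_subgroup[OF B])
  have gen: "difference s f x \<in> ?E" if s: "s \<in> S" and x: "x \<in> carrier D" for s x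
  proof -
    have "s \<in> carrier D" using S s by blast
    moreover have n: "?n = \<nu> s * (n1 * prod \<nu> (S - {s}))"
      using prod.remove[OF S(1) s, of \<nu>] by simp
    ultimately show ?thesis unfolding n using mult[OF _ \<nu>(2)[OF s x]] fc x by simp
  qed
  have "f x [^]\<^bsub>A\<^esub> ?n \<in> B" if x: "x \<in> carrier D" for x
  proof -
    have "difference x f \<one>\<^bsub>D\<^esub> \<in> ?E"
      by (rule difference_in_generate[OF S(2,3) E Suc.prems(1) gen x]) simp_all
    moreover have "f \<one>\<^bsub>D\<^esub> \<in> ?E" using mult[OF _ n1(2)] fc by simp
    ultimately have "difference x f \<one>\<^bsub>D\<^esub> \<otimes>\<^bsub>A\<^esub> f \<one>\<^bsub>D\<^esub> \<in> ?E" by (rule subgroup.m_closed[OF E])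
    then show ?thesis using fc x by (simp add: A.m_assoc)
  qed
  moreover have "0 < ?n" using n1 \<nu> by (simp add: prod_pos)
  ultimately show ?case by blast
qed

text \<open>Modulo a subgroup \<open>H\<close> that is maximal with respect to meeting the powers of \<open>a = f x0\<close>
  trivially, the group is torsion-free of rank one, and \<open>P x\<close> is the exponent of \<open>a\<close> in a fixed
  power of \<open>f x\<close>.\<close>

lemma exists_int_poly:
  assumes S: "finite S" "S \<subseteq> carrier D" "generate D S = carrier D"
    and f: "f \<in> carrier D \<rightarrow> carrier A" "poly_mod {\<one>\<^bsub>A\<^esub>} m f"
    and x0: "x0 \<in> carrier D" "\<And>n::nat. 0 < n \<Longrightarrow> f x0 [^]\<^bsub>A\<^esub> n \<noteq> \<one>\<^bsub>A\<^esub>"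
  shows "\<exists>P. D.int_poly 0 m P \<and> P x0 \<noteq> 0 \<and> (\<forall>x\<in>carrier D. f x = \<one>\<^bsub>A\<^esub> \<longrightarrow> P x = 0)"
proof -
  define a where "a = f x0"
  have a: "a \<in> carrier A" using f(1) x0(1) by (auto simp: a_def)
  have fc: "f y \<in> carrier A" if "y \<in> carrier D" for y using f(1) that by blast
  obtain H where H: "subgroup H A" "\<And>n::nat. 0 < n \<Longrightarrow> a [^]\<^bsub>A\<^esub> n \<notin> H"
    and rank: "\<And>b. b \<in> carrier A \<Longrightarrow> \<exists>n>0::nat. \<exists>i::int. \<exists>h\<in>H. b [^]\<^bsub>A\<^esub> n = a [^]\<^bsub>A\<^esub> i \<otimes>\<^bsub>A\<^esub> h"
    using A.exists_maximal_disjoint_subgroup[OF a] x0(2) unfolding a_def by metis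
  interpret H: subgroup H A by fact
  have int_pow: "i = 0" if "a [^]\<^bsub>A\<^esub> (i::int) \<in> H" for i
  proof (rule ccontr)
    assume "i \<noteq> 0"
    then consider "0 < i" | "i < 0" by linarith
    then show False
    proof cases
      case 1
      then show False using H(2)[of "nat i"] that int_pow_int[of A a "nat i", symmetric] by simp
    next
      case 2
      have "a [^]\<^bsub>A\<^esub> (- i) \<in> H" using H.m_inv_closed[OF that] a by (simp add: A.int_pow_neg)
      then show False using 2 H(2)[of "nat (- i)"] int_pow_int[of A a "nat (- i)", symmetric] by simp
    qed
  qed
  let ?B = "{a [^]\<^bsub>A\<^esub> (i::int) \<otimes>\<^bsub>A\<^esub> h | i h. h \<in> H}"
  have B: "subgroup ?B A"
  proof (rule A.subgroupI)
    show "?B \<subseteq> carrier A" using a by auto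
    show "?B \<noteq> {}" using H.one_closed by blast
    fix x assume "x \<in> ?B"
    then obtain i h where x: "x = a [^]\<^bsub>A\<^esub> (i::int) \<otimes>\<^bsub>A\<^esub> h" "h \<in> H" by blast
    have "inv\<^bsub>A\<^esub> x = a [^]\<^bsub>A\<^esub> (- i) \<otimes>\<^bsub>A\<^esub> inv\<^bsub>A\<^esub> h" using x a by (simp add: A.inv_mult A.int_pow_neg)
    then show "inv\<^bsub>A\<^esub> x \<in> ?B" using x by blast
    fix y assume "y \<in> ?B"
    then obtain j h' where y: "y = a [^]\<^bsub>A\<^esub> (j::int) \<otimes>\<^bsub>A\<^esub> h'" "h' \<in> H" by blast
    have "x \<otimes>\<^bsub>A\<^esub> y = a [^]\<^bsub>A\<^esub> (i + j) \<otimes>\<^bsub>A\<^esub> (h \<otimes>\<^bsub>A\<^esub> h')" using x y a by (simp add: A.int_pow_mult A.m_ac)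
    then show "x \<otimes>\<^bsub>A\<^esub> y \<in> ?B" using x y by blast
  qed
  have "\<exists>n>0::nat. \<forall>x\<in>carrier D. f x [^]\<^bsub>A\<^esub> n \<in> ?B"
  proof (rule bounded_exponent[OF S B f(1)])
    show "poly_mod ?B m f"
      by (rule poly_mod_mono[OF f(2)]) (use subgroup.one_closed[OF B] in blast)
    show "\<exists>n>0::nat. f x [^]\<^bsub>A\<^esub> n \<in> ?B" if "x \<in> carrier D" for x
      using rank[OF fc[OF that]] by blast
  qed
  then obtain M where M: "0 < (M::nat)" "\<And>x. x \<in> carrier D \<Longrightarrow> f x [^]\<^bsub>A\<^esub> M \<in> ?B" by blast
  have "\<exists>i. f x [^]\<^bsub>A\<^esub> M \<otimes>\<^bsub>A\<^esub> a [^]\<^bsub>A\<^esub> (- i :: int) \<in> H" if x: "x \<in> carrier D" for x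
  proof -
    obtain i h where ih: "f x [^]\<^bsub>A\<^esub> M = a [^]\<^bsub>A\<^esub> (i::int) \<otimes>\<^bsub>A\<^esub> h" "h \<in> H" using M(2)[OF x] by blast
    then have "f x [^]\<^bsub>A\<^esub> M \<otimes>\<^bsub>A\<^esub> a [^]\<^bsub>A\<^esub> (- i) = h" using a by (simp add: A.int_pow_neg A.m_ac)
    then show ?thesis using ih(2) by metis
  qed
  then obtain P where P: "\<And>x. x \<in> carrier D \<Longrightarrow> f x [^]\<^bsub>A\<^esub> M \<otimes>\<^bsub>A\<^esub> a [^]\<^bsub>A\<^esub> (- P x :: int) \<in> H" by metis
  have zero: "Q x = 0" if "h x = \<one>\<^bsub>A\<^esub>" "h x [^]\<^bsub>A\<^esub> M \<otimes>\<^bsub>A\<^esub> a [^]\<^bsub>A\<^esub> (- Q x :: int) \<in> H"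
    for h :: "'d \<Rightarrow> 'a" and Q x
    using that int_pow[of "- Q x"] a by simp
  \<comment> \<open>The relation tying the exponent \<open>Q\<close> to \<open>h\<close> is
    multiplicative, so differences of \<open>Q\<close> belong to differences of \<open>h\<close>.
    Once the latter are trivial, the exponent is 0, because no nonzero power of \<open>a\<close>
    lies in \<open>H\<close>.\<close>
  have poly: "D.int_poly 0 m Q"
    if "h \<in> carrier D \<rightarrow> carrier A" "poly_mod {\<one>\<^bsub>A\<^esub>} m h"
      "\<And>x. x \<in> carrier D \<Longrightarrow> h x [^]\<^bsub>A\<^esub> M \<otimes>\<^bsub>A\<^esub> a [^]\<^bsub>A\<^esub> (- Q x :: int) \<in> H" for h Q
    using that
  proof (induction m arbitrary: h Q)
    case 0
    then show ?case using zero by simp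
  next
    case (Suc m)
    have "D.int_poly 0 m (\<lambda>x. Q (g \<otimes>\<^bsub>D\<^esub> x) - Q x)" if g: "g \<in> carrier D" for g
    proof (rule Suc.IH)
      show "difference g h \<in> carrier D \<rightarrow> carrier A" "poly_mod {\<one>\<^bsub>A\<^esub>} m (difference g h)"
        using Suc.prems(1,2) g by (auto simp: Pi_iff)
      fix x assume x: "x \<in> carrier D"
      let ?u = "\<lambda>x. h x [^]\<^bsub>A\<^esub> M \<otimes>\<^bsub>A\<^esub> a [^]\<^bsub>A\<^esub> (- Q x :: int)"
      have "h x \<in> carrier A" "h (g \<otimes>\<^bsub>D\<^esub> x) \<in> carrier A" using Suc.prems(1) g x by auto
      then have "difference g h x [^]\<^bsub>A\<^esub> M \<otimes>\<^bsub>A\<^esub> a [^]\<^bsub>A\<^esub> (- (Q (g \<otimes>\<^bsub>D\<^esub> x) - Q x))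
          = ?u (g \<otimes>\<^bsub>D\<^esub> x) \<otimes>\<^bsub>A\<^esub> inv\<^bsub>A\<^esub> (?u x)"
        using a by (simp add: A.nat_pow_distrib A.nat_pow_inv A.inv_mult A.int_pow_neg A.int_pow_diff A.m_ac)
      then show "difference g h x [^]\<^bsub>A\<^esub> M \<otimes>\<^bsub>A\<^esub> a [^]\<^bsub>A\<^esub> (- (Q (g \<otimes>\<^bsub>D\<^esub> x) - Q x)) \<in> H"
        using Suc.prems(3) g x by (metis D.m_closed H.m_closed H.m_inv_closed)
    qed
    then show ?case by simp
  qed
  \<comment> \<open>At \<open>x0\<close> the value of \<open>f\<close> is \<open>a\<close> itself,
    so the exponent there is \<open>M\<close>, which is positive.\<close>
  have "a [^]\<^bsub>A\<^esub> (int M - P x0) \<in> H"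
    using P[OF x0(1)] a by (simp add: a_def[symmetric] A.int_pow_diff A.int_pow_neg int_pow_int)
  then have "P x0 \<noteq> 0" using int_pow[of "int M - P x0"] M(1) by simp
  then show ?thesis using poly[OF f P] zero[of f _ P] P by blast
qed

end

section \<open>From maps into a torsion-free nilpotent group to integer-valued polynomials\<close>

context filtered_target
begin

lemma F_normal:
  assumes "F 1 = carrier A" shows "F i \<lhd> A"
  unfolding A.normal_inv_iff
proof (intro conjI ballI F_subgroup)
  fix x h assume x: "x \<in> carrier A" and h: "h \<in> F i"
  have "commutator A x h \<in> F (1 + i)" by (rule F_commutator) (use assms x h in auto)
  then have "commutator A x h \<otimes>\<^bsub>A\<^esub> h \<in> F i"
    using F_Suc[of i] h subgroup.m_closed[OF F_subgroup] by (simp add: subset_iff)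
  then show "x \<otimes>\<^bsub>A\<^esub> h \<otimes>\<^bsub>A\<^esub> inv\<^bsub>A\<^esub> x \<in> F i"
    using x F_carrier[OF h] by (simp add: A.word_simps)
qed

text \<open>Let \<open>f\<close> take values in \<open>F i\<close>. Either some value has infinite order modulo \<open>F (Suc i)\<close>, or
  a power of \<open>f\<close> takes values in \<open>F (Suc i)\<close>, and it still does not vanish because \<open>A\<close> is
  torsion-free.\<close>

lemma exists_int_poly_vanishing:
  assumes S: "finite S" "S \<subseteq> carrier D" "generate D S = carrier D"
    and F: "F 1 = carrier A" "F c = {\<one>\<^bsub>A\<^esub>}" and tf: "torsion_free A"
    and f: "\<And>m. poly_map m 0 f" "x0 \<in> carrier D" "f x0 \<noteq> \<one>\<^bsub>A\<^esub>"
  shows "\<exists>m P. D.int_poly 0 m P \<and> (\<exists>x\<in>carrier D. P x \<noteq> 0) \<and>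
    (\<forall>x\<in>carrier D. f x = \<one>\<^bsub>A\<^esub> \<longrightarrow> P x = 0)"
proof -
  have "c \<noteq> 0"
  proof
    assume "c = 0"
    then have "F 1 \<subseteq> {\<one>\<^bsub>A\<^esub>}" using F_Suc[of 0] F(2) by simp
    then show False using F(1) f(2,3) poly_map_carrier[OF f(1)[of 0]] by blast
  qed
  then have "1 \<le> c" by simp
  \<comment> \<open>Induction on \<open>i\<close> downwards from \<open>c\<close>, where
    \<open>F c\<close> is trivial and contradicts \<open>f x0\<close>. Powers of \<open>f\<close>
    remain polynomial at level 0, so the degree bound \<open>c\<close> is kept throughout.\<close>
  have claim: "\<exists>P. D.int_poly 0 c P \<and> (\<exists>x\<in>carrier D. P x \<noteq> 0) \<and>
    (\<forall>x\<in>carrier D. f x = \<one>\<^bsub>A\<^esub> \<longrightarrow> P x = 0)"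
    if "i \<le> c" "1 \<le> i" "poly_map c 0 f" "\<forall>x\<in>carrier D. f x \<in> F i" "f x0 \<noteq> \<one>\<^bsub>A\<^esub>" for i f
    using that
  proof (induction i arbitrary: f rule: inc_induct)
    case base
    then show ?case using F(2) f(2) by blast
  next
    case (step i)
    let ?B = "A\<lparr>carrier := F i\<rparr>"
    let ?Q = "?B Mod F (Suc i)"
    interpret B: group ?B by (rule subgroup.subgroup_is_group[OF F_subgroup A.group_axioms])
    have normal: "F (Suc i) \<lhd> ?B"
      by (rule A.normal_restrict_supergroup[OF F_subgroup F_normal[OF F(1)] F_Suc])
    interpret N: normal "F (Suc i)" ?B by (rule normal)
    define \<pi> where "\<pi> x = F (Suc i) #>\<^bsub>?B\<^esub> x" for x
    have \<pi>: "\<pi> \<in> hom ?B ?Q" unfolding \<pi>_def by (rule N.r_coset_hom_Mod)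
    have kernel: "\<pi> x = \<one>\<^bsub>?Q\<^esub> \<longleftrightarrow> x \<in> F (Suc i)" if "x \<in> F i" for x
      using B.coset_join1[OF _ _ N.subgroup_axioms, of x] B.coset_join2[OF _ N.subgroup_axioms, of x] that N.subset
      by (auto simp: \<pi>_def FactGroup_def)
    interpret Q: comm_group ?Q
    proof (rule group.group_comm_groupI[OF N.factorgroup_is_group])
      fix X Y assume "X \<in> carrier ?Q" "Y \<in> carrier ?Q"
      then obtain x y where x: "x \<in> F i" "X = \<pi> x" and y: "y \<in> F i" "Y = \<pi> y"
        by (auto simp: FactGroup_def RCOSETS_def \<pi>_def)
      note xy = F_carrier[OF x(1)] F_carrier[OF y(1)]
      \<comment> \<open>This needs \<open>1 \<le> i\<close>, so that i + i is at least Suc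
        i.\<close>
      have "commutator A x y \<in> F (Suc i)"
        using F_commutator[OF x(1) y(1)] F_antimono[of "Suc i" "i + i"] step.prems(1) by auto
      then have c: "commutator A x y \<in> F i" "\<pi> (commutator A x y) = \<one>\<^bsub>?Q\<^esub>" using kernel F_Suc by blast+
      have yx: "y \<otimes>\<^bsub>A\<^esub> x \<in> F i" using x y subgroup.m_closed[OF F_subgroup] by blast
      have "x \<otimes>\<^bsub>A\<^esub> y = commutator A x y \<otimes>\<^bsub>A\<^esub> (y \<otimes>\<^bsub>A\<^esub> x)" using xy by (simp add: A.word_simps)
      then have "\<pi> (x \<otimes>\<^bsub>A\<^esub> y) = \<pi> (commutator A x y) \<otimes>\<^bsub>?Q\<^esub> \<pi> (y \<otimes>\<^bsub>A\<^esub> x)"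
        using hom_mult[OF \<pi>, of "commutator A x y" "y \<otimes>\<^bsub>A\<^esub> x"] c(1) yx by simp
      moreover have "\<pi> (y \<otimes>\<^bsub>A\<^esub> x) \<in> carrier ?Q" using hom_in_carrier[OF \<pi>] yx by simp
      ultimately have "\<pi> (x \<otimes>\<^bsub>A\<^esub> y) = \<pi> (y \<otimes>\<^bsub>A\<^esub> x)"
        using c(2) monoid.l_one[OF group.is_monoid[OF N.factorgroup_is_group]] by metis
      then show "X \<otimes>\<^bsub>?Q\<^esub> Y = Y \<otimes>\<^bsub>?Q\<^esub> X"
        using hom_mult[OF \<pi>, of x y] hom_mult[OF \<pi>, of y x] x y by simp
    qed
    interpret T: abelian_target D ?Q ..
    have \<pi>_inv: "\<pi> (inv\<^bsub>A\<^esub> x) = inv\<^bsub>?Q\<^esub> (\<pi> x)" if "x \<in> F i" for x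
      using group_hom.hom_inv[of ?B ?Q \<pi> x] \<pi> that
      by (simp add: group_hom_def group_hom_axioms_def A.m_inv_consistent[OF F_subgroup])
    \<comment> \<open>The level \<open>j\<close> is independent of \<open>i\<close>: the map
      \<open>f\<close> has level 0 although its values lie in \<open>F i\<close>. After
      \<open>m\<close> differences the values lie in \<open>F (j + m)\<close>, hence in
      \<open>F c\<close>, which dies in the quotient because i < c.\<close>
    have poly_mod: "T.poly_mod {\<one>\<^bsub>?Q\<^esub>} m (\<lambda>x. \<pi> (h x))"
      if "poly_map m j h" "\<forall>x\<in>carrier D. h x \<in> F i" "c \<le> j + m" for m j h
      using that
    proof (induction m arbitrary: j h)
      case 0
      have "F j \<subseteq> F (Suc i)" using 0 step.hyps by (intro F_antimono) simp
      then show ?case using 0 kernel by auto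
    next
      case (Suc m)
      have "T.poly_mod {\<one>\<^bsub>?Q\<^esub>} m (T.difference g (\<lambda>x. \<pi> (h x)))" if g: "g \<in> carrier D" for g
      proof (rule T.poly_mod_cong)
        have inF: "h (g \<otimes>\<^bsub>D\<^esub> x) \<in> F i" "inv\<^bsub>A\<^esub> (h x) \<in> F i" if "x \<in> carrier D" for x
          using Suc.prems(2) g that subgroup.m_inv_closed[OF F_subgroup] by auto
        show "T.poly_mod {\<one>\<^bsub>?Q\<^esub>} m (\<lambda>x. \<pi> (difference g h x))"
        proof (rule Suc.IH[of "Suc j"])
          show "poly_map m (Suc j) (difference g h)" using Suc.prems(1) g by simp
          show "\<forall>x\<in>carrier D. difference g h x \<in> F i"
            using inF subgroup.m_closed[OF F_subgroup] by blast
        qed (use Suc.prems(3) in simp)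
        show "\<pi> (difference g h x) = T.difference g (\<lambda>x. \<pi> (h x)) x" if "x \<in> carrier D" for x
          using hom_mult[OF \<pi>, of "h (g \<otimes>\<^bsub>D\<^esub> x)" "inv\<^bsub>A\<^esub> (h x)"] inF[OF that] \<pi>_inv Suc.prems(2) that
          by simp
      qed
      then show ?case by simp
    qed
    have \<pi>f: "(\<lambda>x. \<pi> (f x)) \<in> carrier D \<rightarrow> carrier ?Q" "T.poly_mod {\<one>\<^bsub>?Q\<^esub>} c (\<lambda>x. \<pi> (f x))"
      using hom_in_carrier[OF \<pi>] step.prems(3) poly_mod[OF step.prems(2,3)] by auto
    have \<pi>_pow: "\<pi> (f x) [^]\<^bsub>?Q\<^esub> n = \<pi> (f x [^]\<^bsub>A\<^esub> n)" "f x [^]\<^bsub>A\<^esub> n \<in> F i"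
      if "x \<in> carrier D" for x and n :: nat
    proof -
      have fx: "f x \<in> carrier ?B" using step.prems(3) that by simp
      show "f x [^]\<^bsub>A\<^esub> n \<in> F i"
        using B.nat_pow_closed[OF fx, of n] by (simp add: A.nat_pow_consistent[symmetric])
      show "\<pi> (f x) [^]\<^bsub>?Q\<^esub> n = \<pi> (f x [^]\<^bsub>A\<^esub> n)"
        using hom_nat_pow[OF \<pi> fx B.group_axioms Q.group_axioms, of n]
        by (simp add: A.nat_pow_consistent[symmetric])
    qed
    show ?case
    proof (cases "\<exists>x1\<in>carrier D. \<forall>n::nat. 0 < n \<longrightarrow> \<pi> (f x1) [^]\<^bsub>?Q\<^esub> n \<noteq> \<one>\<^bsub>?Q\<^esub>")
      case True
      then obtain x1 where x1: "x1 \<in> carrier D" "\<And>n::nat. 0 < n \<Longrightarrow> \<pi> (f x1) [^]\<^bsub>?Q\<^esub> n \<noteq> \<one>\<^bsub>?Q\<^esub>"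
        by blast
      obtain P where P: "D.int_poly 0 c P" "P x1 \<noteq> 0"
        "\<And>x. x \<in> carrier D \<Longrightarrow> \<pi> (f x) = \<one>\<^bsub>?Q\<^esub> \<Longrightarrow> P x = 0"
        using T.exists_int_poly[OF S \<pi>f x1] by blast
      have "P x = 0" if "x \<in> carrier D" "f x = \<one>\<^bsub>A\<^esub>" for x
        using P(3)[OF that(1)] kernel[of "f x"] that step.prems(3)
          subgroup.one_closed[OF F_subgroup] by simp
      then show ?thesis using P x1(1) by blast
    next
      case False
      then have "\<exists>n>0::nat. \<forall>x\<in>carrier D. \<pi> (f x) [^]\<^bsub>?Q\<^esub> n \<in> {\<one>\<^bsub>?Q\<^esub>}"
        by (intro T.bounded_exponent[OF S Q.triv_subgroup \<pi>f]) blast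
      then obtain n where n: "0 < (n::nat)" "\<And>x. x \<in> carrier D \<Longrightarrow> \<pi> (f x) [^]\<^bsub>?Q\<^esub> n = \<one>\<^bsub>?Q\<^esub>"
        by blast
      have "f x [^]\<^bsub>A\<^esub> n \<in> F (Suc i)" if "x \<in> carrier D" for x
        using n(2)[OF that] \<pi>_pow[OF that] kernel by metis
      moreover have "f x0 [^]\<^bsub>A\<^esub> n \<noteq> \<one>\<^bsub>A\<^esub>"
        using tf n(1) step.prems(3,4) f(2) F_carrier unfolding torsion_free_def by blast
      ultimately obtain P where P: "D.int_poly 0 c P" "\<exists>x\<in>carrier D. P x \<noteq> 0"
        "\<forall>x\<in>carrier D. f x [^]\<^bsub>A\<^esub> n = \<one>\<^bsub>A\<^esub> \<longrightarrow> P x = 0"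
        using step.IH[of "\<lambda>x. f x [^]\<^bsub>A\<^esub> n"] poly_map_pow[OF step.prems(2), of n] by auto
      then show ?thesis by (metis A.nat_pow_one)
    qed
  qed
  have "\<forall>x\<in>carrier D. f x \<in> F 1" using poly_map_carrier[OF f(1)[of 0]] F(1) by blast
  from claim[OF \<open>1 \<le> c\<close> _ f(1) this f(3)] show ?thesis by blast
qed

end

section \<open>Finite generation and finite index\<close>

context group
begin

text \<open>Schreier's lemma: the elements \<open>?u t s\<close> rewrite a product of generators
  from left to right while remembering only the representative of its coset.\<close>

lemma finitely_generated_finite_index:
  assumes "finitely_generated G" "finite_index H G"
  shows "finitely_generated (G\<lparr>carrier := H\<rparr>)"
proof -
  obtain S where S: "finite S" "S \<subseteq> carrier G" "generate G S = carrier G"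
    using assms(1) by (auto simp: finitely_generated_def)
  have H: "subgroup H G" and fin: "finite (rcosets H)" using assms(2) by (auto simp: finite_index_def)
  interpret H: subgroup H G by (rule H)
  \<comment> \<open>The coset \<open>H\<close> gets the representative 1, so that an element of
    \<open>H\<close> written as h t with h in \<open>H\<close> has t = 1.\<close>
  define r where "r C = (if C = H then \<one> else SOME x. x \<in> C)" for C
  have r: "r C \<in> C" if C: "C \<in> rcosets H" for C
  proof (cases "C = H")
    case False
    obtain x where "x \<in> C" using C rcos_self[OF _ H] by (auto simp: RCOSETS_def)
    then show ?thesis using False by (auto simp: r_def intro: someI)
  qed (simp add: r_def)
  define T where "T = r ` (rcosets H)"
  have T: "T \<subseteq> carrier G"
    using r H.rcosets_carrier[OF group_axioms] by (auto simp: T_def)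
  have HT: "\<one> \<in> T" using H.subgroup_in_rcosets[OF group_axioms] by (force simp: T_def r_def)
  have TH: "t = \<one>" if t: "t \<in> T" "t \<in> H" for t
  proof -
    obtain C where C: "C \<in> rcosets H" "t = r C" using t(1) unfolding T_def by blast
    then obtain x where x: "x \<in> carrier G" "C = H #> x" by (auto simp: RCOSETS_def)
    have tc: "t \<in> carrier G" using T t by blast
    have "C = H #> t" using repr_independence[OF _ x(1) H, of t] r[OF C(1)] C x(2) by simp
    also have "\<dots> = H" by (rule coset_join2[OF tc H t(2)])
    finally show ?thesis using C by (simp add: r_def)
  qed
  let ?S = "S \<union> m_inv G ` S"
  let ?u = "\<lambda>t s. t \<otimes> s \<otimes> inv (r (H #> (t \<otimes> s)))"
  have S': "?S \<subseteq> carrier G" using S by auto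
  define U where "U = (\<lambda>(t, s). ?u t s) ` (T \<times> ?S)"
  have coset: "H #> (t \<otimes> s) \<in> rcosets H" if "t \<in> T" "s \<in> ?S" for t s
  proof -
    have "t \<in> carrier G" "s \<in> carrier G" using that T S' by blast+
    then show ?thesis by (auto simp: RCOSETS_def)
  qed
  have rH: "r (H #> (t \<otimes> s)) \<in> T" if "t \<in> T" "s \<in> ?S" for t s
    using coset[OF that] by (auto simp: T_def)
  have "finite U" using S(1) fin by (simp add: U_def T_def)
  moreover have "?u t s \<in> H" if ts: "t \<in> T" "s \<in> ?S" for t s
  proof -
    have c: "t \<otimes> s \<in> carrier G" "r (H #> (t \<otimes> s)) \<in> carrier G" using ts T S' rH[OF ts] by auto
    have "t \<otimes> s \<in> H #> r (H #> (t \<otimes> s))"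
      using repr_independence[OF r[OF coset[OF ts]] c(1) H] rcos_self[OF c(1) H] by simp
    then obtain h where h: "h \<in> H" "t \<otimes> s = h \<otimes> r (H #> (t \<otimes> s))" by (auto simp: r_coset_def)
    have "?u t s = h" by (rule inv_solve_right'[THEN iffD2, OF H.mem_carrier[OF h(1)] c h(2)])
    then show ?thesis using h(1) by metis
  qed
  then have UH: "U \<subseteq> H" by (auto simp: U_def)
  moreover have "generate G U = H"
  proof
    show "generate G U \<subseteq> H" by (rule generate_subgroup_incl[OF UH H])
    have Uc: "U \<subseteq> carrier G" using UH H.subset by blast
    interpret U: subgroup "generate G U" G by (rule generate_is_subgroup[OF Uc])
    have letter: "\<exists>h'\<in>generate G U. \<exists>t'\<in>T. h \<otimes> t \<otimes> s = h' \<otimes> t'"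
      if h: "h \<in> generate G U" and t: "t \<in> T" and s: "s \<in> ?S" for h t s
    proof -
      have c: "h \<in> carrier G" "t \<in> carrier G" "s \<in> carrier G" "r (H #> (t \<otimes> s)) \<in> carrier G"
        using U.mem_carrier[OF h] t s T S' rH[OF t s] by auto
      have "?u t s \<in> generate G U" using t s by (intro generate.incl) (auto simp: U_def)
      then have "h \<otimes> ?u t s \<in> generate G U" using h by blast
      moreover have "h \<otimes> t \<otimes> s = h \<otimes> ?u t s \<otimes> r (H #> (t \<otimes> s))" using c by (simp add: m_assoc)
      ultimately show ?thesis using rH[OF t s] by blast
    qed
    have "\<exists>h'\<in>generate G U. \<exists>t'\<in>T. h \<otimes> t \<otimes> g = h' \<otimes> t'"
      if "g \<in> generate G S" "h \<in> generate G U" "t \<in> T" for g h t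
      using that
    proof (induction g arbitrary: h t rule: generate.induct)
      case one
      then have "h \<otimes> t \<in> carrier G" using T U.subset by blast
      then show ?case using one by auto
    next
      case (incl s)
      then show ?case using letter[of h t s] by blast
    next
      case (inv s)
      then show ?case using letter[of h t "inv s"] by blast
    next
      case (eng g1 g2)
      obtain h' t' where 1: "h' \<in> generate G U" "t' \<in> T" "h \<otimes> t \<otimes> g1 = h' \<otimes> t'"
        using eng.IH(1)[OF eng.prems] by blast
      obtain h'' t'' where 2: "h'' \<in> generate G U" "t'' \<in> T" "h' \<otimes> t' \<otimes> g2 = h'' \<otimes> t''"
        using eng.IH(2)[OF 1(1,2)] by blast
      have c: "g1 \<in> carrier G" "g2 \<in> carrier G" "h \<in> carrier G" "t \<in> carrier G"
        using eng S T U.mem_carrier by auto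
      then have "h \<otimes> t \<otimes> (g1 \<otimes> g2) = h \<otimes> t \<otimes> g1 \<otimes> g2" by (simp add: m_assoc)
      then show ?case using 1 2 by metis
    qed
    note decomp = this
    show "H \<subseteq> generate G U"
    proof
      fix x assume x: "x \<in> H"
      then have "x \<in> generate G S" using S(3) H.subset by blast
      from decomp[OF this U.one_closed HT] obtain h t
        where ht: "h \<in> generate G U" "t \<in> T" "\<one> \<otimes> \<one> \<otimes> x = h \<otimes> t" by blast
      have hH: "h \<in> H" using ht(1) generate_subgroup_incl[OF UH H] by blast
      have tc: "t \<in> carrier G" using ht(2) T by blast
      have "t = inv h \<otimes> x" using ht(3) H.mem_carrier[OF hH] tc H.mem_carrier[OF x] by simp
      then have "t \<in> H" using hH x by simp
      then have "t = \<one>" using TH ht(2) by blast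
      then show "x \<in> generate G U" using ht H.mem_carrier[OF x] H.mem_carrier[OF hH] by simp
    qed
  qed
  ultimately show ?thesis
    using generate_consistent[OF UH H] by (auto simp: finitely_generated_def)
qed

lemma finitely_generated_power_group:
  assumes "finitely_generated G"
  shows "finitely_generated (power_group G k)"
proof -
  obtain S where S: "finite S" "S \<subseteq> carrier G" "generate G S = carrier G"
    using assms by (auto simp: finitely_generated_def)
  let ?P = "power_group G k"
  interpret P: group ?P by simp
  define e where "e j a = (\<lambda>i\<in>{1..k}. if i = j then a else \<one>)" for j a
  define U where "U = (\<lambda>(j, s). e j s) ` ({1..k} \<times> S)"
  have e_closed: "e j a \<in> carrier ?P" if "a \<in> carrier G" for j a
    using that by (auto simp: e_def)
  have U: "U \<subseteq> carrier ?P"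
  proof
    fix u assume "u \<in> U"
    then obtain j s where "u = e j s" "s \<in> S" unfolding U_def by force
    then show "u \<in> carrier ?P" using e_closed[of s j] S(2) by (simp only: subsetD)
  qed
  interpret U: subgroup "generate ?P U" ?P by (rule P.generate_is_subgroup[OF U])
  have e: "e j a \<in> generate ?P U" if "a \<in> generate G S" and j: "j \<in> {1..k}" for a j
    using that(1)
  proof (induction a rule: generate.induct)
    case one
    have "e j \<one> = \<one>\<^bsub>?P\<^esub>" by (auto simp: e_def)
    then show ?case using generate.one[of ?P U] by metis
  next
    case (incl s)
    then show ?case using j by (intro generate.incl) (auto simp: U_def)
  next
    case (inv s)
    then have s: "s \<in> carrier G" using S by blast
    have "e j (inv s) = inv\<^bsub>?P\<^esub> (e j s)"
      using e_closed[OF s, of j] by (subst inv_product_group) (auto simp: e_def fun_eq_iff)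
    moreover have "e j s \<in> U" using inv j by (auto simp: U_def)
    ultimately show ?case using generate.inv[of "e j s" U ?P] by metis
  next
    case (eng a b)
    then have ab: "a \<in> carrier G" "b \<in> carrier G" using S by auto
    have "e j (a \<otimes> b) = e j a \<otimes>\<^bsub>?P\<^esub> e j b" using ab by (auto simp: e_def)
    then show ?case using generate.eng[OF eng.IH] by metis
  qed
  have "x \<in> generate ?P U" if x: "x \<in> carrier ?P" for x
  proof -
    let ?x = "\<lambda>n. \<lambda>i\<in>{1..k}. if i \<le> n then x i else \<one>"
    have "n \<le> k \<Longrightarrow> ?x n \<in> generate ?P U" for n
    proof (induction n)
      case 0
      have "?x 0 = \<one>\<^bsub>?P\<^esub>" by (auto simp: fun_eq_iff)
      then show ?case using generate.one[of ?P U] by metis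
    next
      case (Suc n)
      have "e (Suc n) (x (Suc n)) \<in> generate ?P U"
        using Suc.prems x S(3) by (intro e) (auto simp: PiE_iff)
      with Suc.IH[OF Suc_leD[OF Suc.prems]]
      have "?x n \<otimes>\<^bsub>?P\<^esub> e (Suc n) (x (Suc n)) \<in> generate ?P U" by (rule generate.eng)
      moreover have "?x n \<otimes>\<^bsub>?P\<^esub> e (Suc n) (x (Suc n)) = ?x (Suc n)"
        using x by (auto simp: e_def fun_eq_iff PiE_iff le_Suc_eq)
      ultimately show ?case by metis
    qed
    from this[of k] have "?x k \<in> generate ?P U" by simp
    moreover have "?x k = x" using x by (auto simp: PiE_iff extensional_def fun_eq_iff)
    ultimately show ?thesis by metis
  qed
  then have "generate ?P U = carrier ?P" using U.subset by blast
  moreover have "finite U" using S(1) by (simp add: U_def)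
  ultimately show ?thesis using U unfolding finitely_generated_def by blast
qed

text \<open>Writing g as h times the chosen representative of its \<open>H\<close>-coset turns K g
  into a translate of K h, so a pair of cosets determines it.\<close>

lemma finite_rcosets_trans:
  assumes H: "subgroup H G" "finite (rcosets H)"
    and K: "subgroup K (G\<lparr>carrier := H\<rparr>)" "finite (rcosets\<^bsub>G\<lparr>carrier := H\<rparr>\<^esub> K)"
  shows "finite (rcosets K)"
proof -
  interpret H: subgroup H G by fact
  have KH: "K \<subseteq> H" using subgroup.subset[OF K(1)] by simp
  define r where "r C = (SOME x. x \<in> C)" for C :: "'a set"
  have "rcosets K \<subseteq> (\<lambda>(E, C). E #> r C) ` ((rcosets\<^bsub>G\<lparr>carrier := H\<rparr>\<^esub> K) \<times> rcosets H)"
  proof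
    fix X assume "X \<in> rcosets K"
    then obtain g where g: "g \<in> carrier G" "X = K #> g" by (auto simp: RCOSETS_def)
    let ?C = "H #> g"
    have rC: "r ?C \<in> ?C" unfolding r_def by (rule someI) (rule rcos_self[OF g(1) H(1)])
    then have rc: "r ?C \<in> carrier G" using H.elemrcos_carrier[OF group_axioms g(1)] by blast
    have "g \<in> H #> r ?C" using repr_independence[OF rC g(1) H(1)] rcos_self[OF g(1) H(1)] by simp
    then obtain h where h: "h \<in> H" "g = h \<otimes> r ?C" by (auto simp: r_coset_def)
    have "X = (K #> h) #> r ?C"
      using coset_mult_assoc[of K h "r ?C"] KH H.subset h rc g(2) by auto
    moreover have "K #> h \<in> rcosets\<^bsub>G\<lparr>carrier := H\<rparr>\<^esub> K"
      using h by (auto simp: RCOSETS_def r_coset_def)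
    moreover have "?C \<in> rcosets H" using g(1) by (auto simp: RCOSETS_def)
    ultimately show "X \<in> (\<lambda>(E, C). E #> r C) ` ((rcosets\<^bsub>G\<lparr>carrier := H\<rparr>\<^esub> K) \<times> rcosets H)"
      by blast
  qed
  then show ?thesis by (rule finite_subset) (use H K in blast)
qed

lemma power_group_subgroup:
  assumes "subgroup H G"
  shows "subgroup (\<Pi>\<^sub>E i\<in>{1..k}. H) (power_group G k)"
proof -
  interpret H: subgroup H G by fact
  interpret P: group "power_group G k" by simp
  have sub: "(\<Pi>\<^sub>E i\<in>{1..k}. H) \<subseteq> carrier (power_group G k)" using H.subset by (auto simp: PiE_iff)
  show ?thesis
  proof (rule P.subgroupI[OF sub])
    have "(\<lambda>i\<in>{1..k}. \<one>) \<in> (\<Pi>\<^sub>E i\<in>{1..k}. H)" by simp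
    then show "(\<Pi>\<^sub>E i\<in>{1..k}. H) \<noteq> {}" by blast
    fix a assume a: "a \<in> (\<Pi>\<^sub>E i\<in>{1..k}. H)"
    then have "a \<in> (\<Pi>\<^sub>E i\<in>{1..k}. carrier G)" using sub by auto
    then show "inv\<^bsub>power_group G k\<^esub> a \<in> (\<Pi>\<^sub>E i\<in>{1..k}. H)"
      using a by (subst inv_product_group) (auto simp: PiE_iff)
    fix b assume "b \<in> (\<Pi>\<^sub>E i\<in>{1..k}. H)"
    then show "a \<otimes>\<^bsub>power_group G k\<^esub> b \<in> (\<Pi>\<^sub>E i\<in>{1..k}. H)"
      using a by (auto simp: PiE_iff)
  qed
qed

text \<open>A coset of the power of \<open>H\<close> is a product of cosets of \<open>H\<close>, of
  which there are finitely many families.\<close>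

lemma power_group_finite_index:
  assumes "finite_index H G"
  shows "finite_index (\<Pi>\<^sub>E i\<in>{1..k}. H) (power_group G k)"
proof -
  have H: "subgroup H G" and fin: "finite (rcosets H)" using assms by (auto simp: finite_index_def)
  interpret H: subgroup H G by fact
  let ?P = "power_group G k"
  let ?HK = "\<Pi>\<^sub>E i\<in>{1..k}. H"
  interpret P: group ?P by simp
  have HK: "subgroup ?HK ?P" by (rule power_group_subgroup[OF H])
  have "rcosets\<^bsub>?P\<^esub> ?HK \<subseteq> (\<lambda>\<psi>. \<Pi>\<^sub>E i\<in>{1..k}. \<psi> i) ` ({1..k} \<rightarrow>\<^sub>E rcosets H)"
  proof
    fix X assume "X \<in> rcosets\<^bsub>?P\<^esub> ?HK"
    then obtain c where c: "c \<in> carrier ?P" "X = ?HK #>\<^bsub>?P\<^esub> c" by (auto simp: RCOSETS_def)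
    let ?\<psi> = "\<lambda>i\<in>{1..k}. H #> c i"
    have "X = (\<Pi>\<^sub>E i\<in>{1..k}. ?\<psi> i)"
    proof (intro subset_antisym subsetI)
      fix x assume "x \<in> X"
      then obtain h where "h \<in> ?HK" "x = h \<otimes>\<^bsub>?P\<^esub> c" by (auto simp: c r_coset_def)
      then show "x \<in> (\<Pi>\<^sub>E i\<in>{1..k}. ?\<psi> i)" by (auto simp: r_coset_def PiE_iff)
    next
      fix x assume x: "x \<in> (\<Pi>\<^sub>E i\<in>{1..k}. ?\<psi> i)"
      then have "\<forall>i\<in>{1..k}. \<exists>h\<in>H. x i = h \<otimes> c i" by (auto simp: r_coset_def PiE_iff)
      then obtain h where h: "\<And>i. i \<in> {1..k} \<Longrightarrow> h i \<in> H \<and> x i = h i \<otimes> c i" by metis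
      have "x = restrict h {1..k} \<otimes>\<^bsub>?P\<^esub> c"
        using x h by (auto simp: PiE_iff extensional_def fun_eq_iff)
      moreover have "restrict h {1..k} \<in> ?HK" using h by auto
      ultimately show "x \<in> X" unfolding c r_coset_def by blast
    qed
    moreover have "?\<psi> \<in> {1..k} \<rightarrow>\<^sub>E rcosets H" using c(1) by (auto simp: RCOSETS_def PiE_iff)
    ultimately show "X \<in> (\<lambda>\<psi>. \<Pi>\<^sub>E i\<in>{1..k}. \<psi> i) ` ({1..k} \<rightarrow>\<^sub>E rcosets H)" by blast
  qed
  moreover have "finite ({1..k} \<rightarrow>\<^sub>E rcosets H)" using fin by (intro finite_PiE) auto
  ultimately have "finite (rcosets\<^bsub>?P\<^esub> ?HK)" by (meson finite_imageI finite_subset)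
  then show ?thesis using HK by (simp add: finite_index_def)
qed

end

section \<open>Equations on cosets\<close>

text \<open>The filtration is shifted by one step, so that it starts with \<open>N, N\<close>.\<close>

lemma (in group) lower_central_filtration:
  fixes D :: "('d, 'e) monoid_scheme"
  assumes "group D"
  shows "filtered_target D G (\<lambda>i. lower_central_series G (i - 1))"
proof -
  show ?thesis
  proof (rule filtered_target.intro[OF assms group_axioms filtered_target_axioms.intro])
    fix i
    show "subgroup (lower_central_series G (i - 1)) G"
      by (rule normal_imp_subgroup[OF lower_central_series_normal])
    show "lower_central_series G (Suc i - 1) \<subseteq> lower_central_series G (i - 1)"
      using lower_central_series_Suc_subset[of "i - 1"] by (cases i) auto
    fix x j y
    assume x: "x \<in> lower_central_series G (i - 1)" and y: "y \<in> lower_central_series G (j - 1)"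
    then have "x \<in> carrier G" "y \<in> carrier G" using lower_central_series_subset by blast+
    \<comment> \<open>For positive indices the shift by one matches the \<open>Suc\<close> in the
      commutator formula exactly. If an index is 0, truncated subtraction leaves the other term
      unchanged and normality is enough.\<close>
    with x y show "commutator G x y \<in> lower_central_series G (i + j - 1)"
      using lower_central_series_commutators[OF x y]
        commutator_in_normal[OF lower_central_series_normal, of x y]
      by (cases i; cases j) auto
  qed
qed

lemma (in group) word_value_carrier:
  assumes "x \<in> carrier (power_group G k)" "w \<in> words G k"
  shows "word_value G (\<lambda>a. a) x w \<in> carrier G"
  by (rule word_value_closed[OF group_axioms _ _ assms(2)]) (use assms(1) in \<open>auto simp: PiE_iff\<close>)

text \<open>The conjugation by \<open>g\<close> absorbs, in the induction, the letters of the word to the left of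
  the current one.\<close>

lemma (in group) word_map_poly:
  fixes c :: "nat \<Rightarrow> 'a"
  assumes N: "N \<lhd> G" and D: "D = (power_group G k)\<lparr>carrier := \<Pi>\<^sub>E i\<in>{1..k}. N\<rparr>"
    and F: "filtered_target D (G\<lparr>carrier := N\<rparr>) F" "F 0 = N" "F 1 = N"
    and c: "c \<in> carrier (power_group G k)" and w: "w \<in> words G k" and g: "g \<in> carrier G"
  shows "filtered_target.poly_map D (G\<lparr>carrier := N\<rparr>) F m 0
    (\<lambda>x. g \<otimes> word_value G (\<lambda>a. a) (x \<otimes>\<^bsub>power_group G k\<^esub> c) w
      \<otimes> inv (word_value G (\<lambda>a. a) c w) \<otimes> inv g)"
  using w g
proof (induction w arbitrary: g)
  let ?P = "power_group G k" and ?A = "G\<lparr>carrier := N\<rparr>"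
  interpret N: normal N G by (rule N)
  interpret F: filtered_target D ?A F by (rule F)
  interpret P: group ?P by simp
  case Nil
  have "F.poly_map m 0 (\<lambda>_. \<one>)" by (rule F.poly_map_const) (use F(2) N.one_closed in auto)
  then show ?case by (rule F.poly_map_cong) (use Nil assms in \<open>simp\<close>)
next
  let ?P = "power_group G k" and ?A = "G\<lparr>carrier := N\<rparr>"
  interpret N: normal N G by (rule N)
  interpret F: filtered_target D ?A F by (rule F)
  interpret P: group ?P by simp
  case (Cons l w)
  let ?v = "\<lambda>x. word_value G (\<lambda>a. a) (x \<otimes>\<^bsub>?P\<^esub> c) w" and ?vc = "word_value G (\<lambda>a. a) c w"
  have l: "[l] \<in> words G k" and w: "w \<in> words G k" using Cons.prems(1) words_Cons[of l w] by blast+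
  have xP: "x \<in> carrier ?P" if "x \<in> carrier D" for x using that N.subset by (auto simp: D PiE_iff)
  have v: "?v x \<in> carrier G" if "x \<in> carrier D" for x
    using xP[OF that] c w by (intro word_value_carrier[of _ k] P.m_closed)
  have v0: "?vc \<in> carrier G" by (rule word_value_carrier[OF c w])
  have coord: "x i \<in> N" "x i \<in> carrier G" "(x \<otimes>\<^bsub>?P\<^esub> c) i = x i \<otimes> c i" if "x \<in> carrier D" "i \<in> {1..k}" for x i
    using that N.subset by (auto simp: D PiE_iff)
  have ci: "c i \<in> carrier G" if "i \<in> {1..k}" for i using c that by (auto simp: PiE_iff)
  have conj: "F.poly_map m 0 (\<lambda>x. h \<otimes> x i \<otimes> inv h)" if h: "h \<in> carrier G" and i: "i \<in> {1..k}" for h i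
  proof (rule F.poly_map_hom)
    show "(\<lambda>x. h \<otimes> x i \<otimes> inv h) \<in> hom D ?A"
    proof (rule homI)
      fix x y assume x: "x \<in> carrier D" and y: "y \<in> carrier D"
      show "h \<otimes> x i \<otimes> inv h \<in> carrier ?A" using normal_conj[OF N coord(1)[OF x i] h] by simp
      have "(x \<otimes>\<^bsub>D\<^esub> y) i = x i \<otimes> y i" using i by (simp add: D)
      then show "h \<otimes> (x \<otimes>\<^bsub>D\<^esub> y) i \<otimes> inv h = h \<otimes> x i \<otimes> inv h \<otimes>\<^bsub>?A\<^esub> (h \<otimes> y i \<otimes> inv h)"
        using coord(2)[OF x i] coord(2)[OF y i] h by (simp add: word_simps)
    qed
  qed (use F in auto)
  have IH: "F.poly_map m 0 (\<lambda>x. h \<otimes> ?v x \<otimes> inv ?vc \<otimes> inv h)" if "h \<in> carrier G" for h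
    using Cons.IH[OF w that] .
  show ?case
  proof (cases l)
    case (Var i)
    then have i: "i \<in> {1..k}" using l by simp
    show ?thesis
    proof (rule F.poly_map_cong[OF F.poly_map_mult[OF conj[OF Cons.prems(2) i] IH[of "g \<otimes> c i"]]])
      fix x assume x: "x \<in> carrier D"
      show "g \<otimes> x i \<otimes> inv g \<otimes>\<^bsub>?A\<^esub> (g \<otimes> c i \<otimes> ?v x \<otimes> inv ?vc \<otimes> inv (g \<otimes> c i)) =
        g \<otimes> word_value G (\<lambda>a. a) (x \<otimes>\<^bsub>?P\<^esub> c) (l # w) \<otimes> inv (word_value G (\<lambda>a. a) c (l # w)) \<otimes> inv g"
        using Cons.prems(2) v[OF x] v0 coord(2)[OF x i] ci[OF i] coord(3)[OF x i]
        by (simp add: Var word_simps del: mult_product_group)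
    qed (use Cons.prems(2) ci[OF i] in simp)
  next
    case (VarInv i)
    then have i: "i \<in> {1..k}" using l by simp
    \<comment> \<open>The inverse of x i times c i begins with the inverse of \<open>c i\<close>, so
      here the prefix grows before the factor from \<open>x i\<close> is split off.\<close>
    let ?h = "g \<otimes> inv (c i)"
    have h: "?h \<in> carrier G" using Cons.prems(2) ci[OF i] by simp
    show ?thesis
    proof (rule F.poly_map_cong[OF F.poly_map_mult[OF F.poly_map_inv[OF conj[OF h i]] IH[OF h]]])
      fix x assume x: "x \<in> carrier D"
      have "inv\<^bsub>?A\<^esub> (?h \<otimes> x i \<otimes> inv ?h) = inv (?h \<otimes> x i \<otimes> inv ?h)"
        by (rule m_inv_consistent[OF N.subgroup_axioms normal_conj[OF N coord(1)[OF x i] h]])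
      then show "inv\<^bsub>?A\<^esub> (?h \<otimes> x i \<otimes> inv ?h) \<otimes>\<^bsub>?A\<^esub> (?h \<otimes> ?v x \<otimes> inv ?vc \<otimes> inv ?h) =
        g \<otimes> word_value G (\<lambda>a. a) (x \<otimes>\<^bsub>?P\<^esub> c) (l # w) \<otimes> inv (word_value G (\<lambda>a. a) c (l # w)) \<otimes> inv g"
        using Cons.prems(2) v[OF x] v0 coord(2)[OF x i] ci[OF i] coord(3)[OF x i]
        by (simp add: VarInv word_simps del: mult_product_group)
    qed
  next
    case (Const a)
    then have a: "a \<in> carrier G" using l by simp
    show ?thesis
    proof (rule F.poly_map_cong[OF IH[of "g \<otimes> a"]])
      fix x assume x: "x \<in> carrier D"
      show "g \<otimes> a \<otimes> ?v x \<otimes> inv ?vc \<otimes> inv (g \<otimes> a) =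
        g \<otimes> word_value G (\<lambda>a. a) (x \<otimes>\<^bsub>?P\<^esub> c) (l # w) \<otimes> inv (word_value G (\<lambda>a. a) c (l # w)) \<otimes> inv g"
        using Cons.prems(2) v[OF x] v0 a by (simp add: Const word_simps del: mult_product_group)
    qed (use Cons.prems(2) a in simp)
  qed
qed

section \<open>From polynomials on cosets to negligible sets\<close>

lemma (in group) power_group_normal:
  assumes "H \<lhd> G"
  shows "(\<Pi>\<^sub>E i\<in>{1..k}. H) \<lhd> power_group G k"
proof -
  interpret H: normal H G by fact
  interpret P: group "power_group G k" by simp
  show ?thesis
    unfolding P.normal_inv_iff
  proof (intro conjI ballI power_group_subgroup H.subgroup_axioms)
    fix x h assume x: "x \<in> carrier (power_group G k)" and h: "h \<in> (\<Pi>\<^sub>E i\<in>{1..k}. H)"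
    have "x i \<otimes> h i \<otimes> inv (x i) \<in> H" if "i \<in> {1..k}" for i
      using x h that by (intro normal_conj[OF assms]) (auto simp: PiE_iff)
    moreover have "inv\<^bsub>power_group G k\<^esub> x = (\<lambda>i\<in>{1..k}. inv (x i))"
      using x by (subst inv_product_group) auto
    ultimately show "x \<otimes>\<^bsub>power_group G k\<^esub> h \<otimes>\<^bsub>power_group G k\<^esub> inv\<^bsub>power_group G k\<^esub> x
        \<in> (\<Pi>\<^sub>E i\<in>{1..k}. H)"
      by simp
  qed
qed

lemma (in group) conj_iso_normal:
  assumes "H \<lhd> G" "g \<in> carrier G"
  shows "(\<lambda>x. g \<otimes> x \<otimes> inv g) \<in> iso (G\<lparr>carrier := H\<rparr>) (G\<lparr>carrier := H\<rparr>)"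
proof -
  interpret H: normal H G by fact
  have conj: "h \<otimes> x \<otimes> inv h \<in> H" if "x \<in> H" "h \<in> carrier G" for x h
    using normal_conj[OF assms(1) that] .
  have "bij_betw (\<lambda>x. g \<otimes> x \<otimes> inv g) H H"
  proof (rule bij_betw_byWitness[where f' = "\<lambda>x. inv g \<otimes> x \<otimes> g"])
    show "\<forall>x\<in>H. inv g \<otimes> (g \<otimes> x \<otimes> inv g) \<otimes> g = x" "\<forall>x\<in>H. g \<otimes> (inv g \<otimes> x \<otimes> g) \<otimes> inv g = x"
      using assms(2) by (simp_all add: m_assoc)
    show "(\<lambda>x. g \<otimes> x \<otimes> inv g) ` H \<subseteq> H" using conj assms(2) by blast
    show "(\<lambda>x. inv g \<otimes> x \<otimes> g) ` H \<subseteq> H" using conj[of _ "inv g"] assms(2) by auto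
  qed
  moreover have "(\<lambda>x. g \<otimes> x \<otimes> inv g) \<in> hom (G\<lparr>carrier := H\<rparr>) (G\<lparr>carrier := H\<rparr>)"
    by (rule homI) (use conj assms(2) in \<open>auto simp: word_simps\<close>)
  ultimately show ?thesis by (simp add: iso_def)
qed

text \<open>The set \<open>B\<close>, the polynomials and their degrees are fixed before \<epsilon>.
  The proportion of cosets of \<open>K\<close> that meet \<open>V\<close> is at most card B * e^2 /
  p, and only the prime \<open>p\<close>, and with it \<open>K\<close>, depends on
  \<epsilon>.\<close>

lemma (in group) negligible_zero_set:
  assumes H: "H \<lhd> G" "finite_index H G" and fg: "finitely_generated G"
    and B: "finite B" "B \<subseteq> carrier G"
    and Q: "\<And>c. c \<in> B \<Longrightarrow> group.int_poly (G\<lparr>carrier := H\<rparr>) 0 (m c) (Q c)"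
      "\<And>c. c \<in> B \<Longrightarrow> z c \<in> H \<and> Q c (z c) \<noteq> 0"
    and V: "\<And>v. v \<in> V \<Longrightarrow> \<exists>c\<in>B. \<exists>x\<in>H. v = x \<otimes> c \<and> Q c x = 0"
  shows "negligible_by_finite_quotients G V"
proof -
  let ?H = "G\<lparr>carrier := H\<rparr>"
  interpret N: normal H G by (rule H(1))
  interpret D: group ?H by (rule N.subgroup_is_group[OF group_axioms])
  obtain S where S: "finite S" "S \<subseteq> carrier ?H" "generate ?H S = carrier ?H"
    using finitely_generated_finite_index[OF fg H(2)] by (auto simp: finitely_generated_def)
  have VG: "V \<subseteq> carrier G"
  proof
    fix v assume "v \<in> V"
    then obtain c x where "c \<in> B" "x \<in> H" "v = x \<otimes> c" using V[of v] by blast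
    then show "v \<in> carrier G" using B(2) N.subset by auto
  qed
  have "\<exists>K. K \<lhd> G \<and> finite_index K G \<and>
      real (card ((\<lambda>v. K #> v) ` V)) \<le> \<epsilon> * real (Coset.order (G Mod K))" if \<epsilon>: "0 < \<epsilon>" for \<epsilon> :: real
  proof -
    define e where "e = (\<Sum>c\<in>B. m c)"
    \<comment> \<open>A prime above this bound exceeds the common degree bound \<open>e\<close>,
      divides none of the nonzero values \<open>Q c (z c)\<close>, and makes card B * e^2 / p at
      most \<epsilon>.\<close>
    define b where "b = e + (\<Sum>c\<in>B. nat \<bar>Q c (z c)\<bar>) + nat \<lceil>real (card B * e\<^sup>2) / \<epsilon>\<rceil>"
    obtain p where p: "prime p" "b < p" using bigger_prime[of b] by blast
    have ep: "e < p" using p by (simp add: b_def)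
    have large: "real (card B * e\<^sup>2) \<le> \<epsilon> * real p"
    proof -
      have "real (card B * e\<^sup>2) / \<epsilon> \<le> real (nat \<lceil>real (card B * e\<^sup>2) / \<epsilon>\<rceil>)" by (rule real_nat_ceiling_ge)
      also have "\<dots> \<le> real p" using p(2) unfolding b_def of_nat_le_iff by linarith
      finally show ?thesis using \<epsilon> by (simp add: pos_divide_le_eq mult.commute)
    qed
    have Qp: "D.int_poly (int p) e (Q c)" if "c \<in> B" for c
    proof -
      have "m c \<le> e" unfolding e_def using B(1) that by (intro member_le_sum) auto
      then show ?thesis using D.int_poly_mono[OF _ D.int_poly_dvd[OF Q(1)[OF that]]] by simp
    qed
    have nonzero: "\<not> int p dvd Q c (z c)" if "c \<in> B" for c
    proof
      assume "int p dvd Q c (z c)"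
      from dvd_imp_le_int[OF conjunct2[OF Q(2)[OF that]] this] have "int p \<le> \<bar>Q c (z c)\<bar>" by simp
      moreover have "nat \<bar>Q c (z c)\<bar> \<le> (\<Sum>c\<in>B. nat \<bar>Q c (z c)\<bar>)"
        using B(1) that by (intro member_le_sum) auto
      ultimately show False using p(2) by (simp add: b_def)
    qed
    define K where "K = D.int_poly_stabilizer (int p) e"
    have KD: "subgroup K ?H" unfolding K_def by (rule D.subgroup_int_poly_stabilizer)
    have KG: "subgroup K G" using incl_subgroup[OF N.subgroup_axioms KD] .
    have KH: "K \<subseteq> H" using subgroup.subset[OF KD] by simp
    \<comment> \<open>Conjugation by an element of \<open>G\<close> restricts to an automorphism of
      \<open>H\<close>, and these preserve the stabilizer.\<close>
    have normal: "K \<lhd> G"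
      unfolding normal_inv_iff K_def
      using KG D.int_poly_stabilizer_iso[OF conj_iso_normal[OF H(1)]] by (auto simp: K_def)
    have normalD: "K \<lhd> ?H" by (rule normal_restrict_supergroup[OF N.subgroup_axioms normal KH])
    have "0 < int p" using p(2) by simp
    have finD: "finite (rcosets\<^bsub>?H\<^esub> K)"
      unfolding K_def by (rule D.finite_rcosets_int_poly_stabilizer[OF S \<open>0 < int p\<close>])
    have fin: "finite (rcosets K)"
      using finite_rcosets_trans[OF N.subgroup_axioms _ KD finD] H(2) by (simp add: finite_index_def)
    have coset_eq: "K #>\<^bsub>?H\<^esub> x = K #> x" for x by (simp add: r_coset_def)
    have rcosets_sub: "rcosets\<^bsub>?H\<^esub> K \<subseteq> rcosets K"
      using N.subset by (auto simp: RCOSETS_def r_coset_def)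
    have inv: "int p dvd Q c (k \<otimes>\<^bsub>?H\<^esub> x) - Q c x" if "c \<in> B" "k \<in> K" "x \<in> carrier ?H" for c k x
      using D.int_poly_stabilizerD[OF _ Qp[OF that(1)] that(3)] that(2) unfolding K_def by blast
    let ?Z = "\<lambda>c. {C \<in> rcosets\<^bsub>?H\<^esub> K. \<forall>x\<in>C. int p dvd Q c x}"
    have finZ: "finite (?Z c)" for c using finD by simp
    have Z: "p * card (?Z c) \<le> e\<^sup>2 * card (rcosets\<^bsub>?H\<^esub> K)" if c: "c \<in> B" for c
      using D.int_poly_zeros_bound[OF normalD finD p(1) ep Qp[OF c] inv[OF c], of "z c"] Q(2)[OF c] nonzero[OF c]
      by simp
    \<comment> \<open>For v = x c the coset K v is the translate by \<open>c\<close> of K x, and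
      \<open>Q c\<close> vanishes modulo \<open>p\<close> on all of K x by invariance.\<close>
    have "(\<lambda>v. K #> v) ` V \<subseteq> (\<Union>c\<in>B. (\<lambda>C. C #> c) ` ?Z c)"
    proof (rule image_subsetI)
      fix v assume "v \<in> V"
      then obtain c x where c: "c \<in> B" and x: "x \<in> H" "v = x \<otimes> c" "Q c x = 0" using V[of v] by blast
      have "int p dvd Q c y" if "y \<in> K #> x" for y
        using that inv[OF c, of _ x] x by (auto simp: r_coset_def)
      moreover have "K #> x \<in> rcosets\<^bsub>?H\<^esub> K" 
        unfolding RCOSETS_def coset_eq using x(1) by auto
      moreover have "K #> v = (K #> x) #> c"
        unfolding x(2) by (rule coset_mult_assoc[symmetric]) (use KH N.subset x(1) B(2) c in auto)
      ultimately show "K #> v \<in> (\<Union>c\<in>B. (\<lambda>C. C #> c) ` ?Z c)" using c by blast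
    qed
    then have "card ((\<lambda>v. K #> v) ` V) \<le> card (\<Union>c\<in>B. (\<lambda>C. C #> c) ` ?Z c)"
      by (rule card_mono[rotated]) (use B(1) finZ in blast)
    also have "\<dots> \<le> (\<Sum>c\<in>B. card ((\<lambda>C. C #> c) ` ?Z c))" by (rule card_UN_le[OF B(1)])
    also have "\<dots> \<le> (\<Sum>c\<in>B. card (?Z c))" by (intro sum_mono card_image_le finZ)
    finally have "p * card ((\<lambda>v. K #> v) ` V) \<le> p * (\<Sum>c\<in>B. card (?Z c))" by simp
    also have "\<dots> \<le> (\<Sum>c\<in>B. e\<^sup>2 * card (rcosets\<^bsub>?H\<^esub> K))"
      unfolding sum_distrib_left by (rule sum_mono) (rule Z)
    also have "\<dots> = card B * e\<^sup>2 * card (rcosets\<^bsub>?H\<^esub> K)" by simp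
    also have "\<dots> \<le> card B * e\<^sup>2 * Coset.order (G Mod K)"
      using card_mono[OF fin rcosets_sub] by (simp add: Coset.order_def FactGroup_def)
    finally have "real p * real (card ((\<lambda>v. K #> v) ` V)) \<le> real (card B * e\<^sup>2) * real (Coset.order (G Mod K))"
      by (simp flip: of_nat_mult)
    also have "\<dots> \<le> \<epsilon> * real p * real (Coset.order (G Mod K))" by (rule mult_right_mono[OF large]) simp
    finally have "real p * real (card ((\<lambda>v. K #> v) ` V)) \<le> real p * (\<epsilon> * real (Coset.order (G Mod K)))"
      by (simp add: mult_ac)
    then have "real (card ((\<lambda>v. K #> v) ` V)) \<le> \<epsilon> * real (Coset.order (G Mod K))"
      using p(2) by simp
    then show ?thesis using normal KG fin by (auto simp: finite_index_def)
  qed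
  then show ?thesis using VG by (simp add: negligible_by_finite_quotients_def)
qed

text \<open>Dividing by the value at \<open>c\<close> gives a polynomial map into \<open>N\<close>.
  If the value at \<open>c\<close> lies in \<open>N\<close>, multiplying it back is harmless;
  otherwise every value on the coset lies outside \<open>N\<close>, there is no solution on it, and
  the constant polynomial 1 serves.\<close>

lemma (in group) word_solutions_polynomial:
  assumes fg: "finitely_generated G" and N: "N \<lhd> G" "finite_index N G"
    and tf: "torsion_free (G\<lparr>carrier := N\<rparr>)" and nilp: "nilpotent_group (G\<lparr>carrier := N\<rparr>)"
    and D: "D = (power_group G k)\<lparr>carrier := \<Pi>\<^sub>E i\<in>{1..k}. N\<rparr>"
    and w: "w \<in> words G k" and c: "c \<in> carrier (power_group G k)"
    and nontrivial: "\<exists>x\<in>carrier D. word_value G (\<lambda>a. a) (x \<otimes>\<^bsub>power_group G k\<^esub> c) w \<noteq> \<one>"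
  shows "\<exists>m Q. group.int_poly D 0 m Q \<and> (\<exists>x\<in>carrier D. Q x \<noteq> 0) \<and>
    (\<forall>x\<in>carrier D. word_value G (\<lambda>a. a) (x \<otimes>\<^bsub>power_group G k\<^esub> c) w = \<one> \<longrightarrow> Q x = 0)"
proof -
  let ?P = "power_group G k" and ?A = "G\<lparr>carrier := N\<rparr>"
  let ?v = "\<lambda>x. word_value G (\<lambda>a. a) (x \<otimes>\<^bsub>?P\<^esub> c) w" and ?vc = "word_value G (\<lambda>a. a) c w"
  interpret N: normal N G by (rule N(1))
  interpret P: group ?P by simp
  interpret A: group ?A by (rule N.subgroup_is_group[OF group_axioms])
  have index: "finite_index (\<Pi>\<^sub>E i\<in>{1..k}. N) ?P" by (rule power_group_finite_index[OF N(2)])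
  have gD: "group D"
    unfolding D by (rule subgroup.subgroup_is_group[OF power_group_subgroup[OF N.subgroup_axioms] P.group_axioms])
  interpret D: group D by (rule gD)
  interpret F: filtered_target D ?A "\<lambda>i. lower_central_series ?A (i - 1)"
    by (rule A.lower_central_filtration[OF gD])
  obtain S where S: "finite S" "S \<subseteq> carrier D" "generate D S = carrier D"
    using P.finitely_generated_finite_index[OF finitely_generated_power_group[OF fg] index]
    unfolding D finitely_generated_def by blast
  obtain n where n: "lower_central_series ?A n = {\<one>}" using nilp by (auto simp: nilpotent_group_def)
  have xP: "x \<in> carrier ?P" if "x \<in> carrier D" for x using that N.subset by (auto simp: D PiE_iff)
  have v: "?v x \<in> carrier G" if "x \<in> carrier D" for x
    using xP[OF that] c w by (intro word_value_carrier[of _ k] P.m_closed)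
  have vc: "?vc \<in> carrier G" by (rule word_value_carrier[OF c w])
  have poly: "F.poly_map m 0 (\<lambda>x. ?v x \<otimes> inv ?vc)" for m
  proof (rule F.poly_map_cong)
    show "F.poly_map m 0 (\<lambda>x. \<one> \<otimes> ?v x \<otimes> inv ?vc \<otimes> inv \<one>)"
      by (rule word_map_poly[OF N(1) D F.filtered_target_axioms _ _ c w]) simp_all
  qed (use v vc in simp)
  show ?thesis
  proof (cases "?vc \<in> N")
    case True
    have poly': "F.poly_map m 0 ?v" for m
    proof (rule F.poly_map_cong[OF F.poly_map_mult[OF poly F.poly_map_const[of ?vc]]])
      show "?v x \<otimes> inv ?vc \<otimes>\<^bsub>?A\<^esub> ?vc = ?v x" if "x \<in> carrier D" for x
        using v[OF that] vc by (simp add: m_assoc)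
    qed (use True in simp)
    obtain x0 where "x0 \<in> carrier D" "?v x0 \<noteq> \<one>" using nontrivial by blast
    then show ?thesis
      using F.exists_int_poly_vanishing[OF S _ _ tf poly', of "Suc n" x0] n by simp
  next
    case False
    have "?v x \<noteq> \<one>" if x: "x \<in> carrier D" for x
    proof
      assume "?v x = \<one>"
      then have "inv ?vc \<in> N" using F.poly_map_carrier[OF poly[of 0] x] vc by simp
      then show False using False N.m_inv_closed vc by (metis inv_inv)
    qed
    moreover have "D.int_poly 0 1 (\<lambda>_. 1)" by simp
    moreover have "\<one>\<^bsub>D\<^esub> \<in> carrier D" by simp
    ultimately show ?thesis by (metis zero_neq_one)
  qed
qed

theorem theorem1p13:
  fixes G :: "('a, 'b) monoid_scheme" and N :: "'a set" and k :: nat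
    and \<phi> :: "'a letter list set"
  assumes "group G"
    and "finitely_generated G"
    and "virtually_nilpotent G"
    and "N \<lhd> G"
    and "finite_index N G"
    and "torsion_free (G\<lparr>carrier := N\<rparr>)"
    and "nilpotent_group (G\<lparr>carrier := N\<rparr>)"
    and "\<phi> \<in> carrier (equation_group G k)"
  shows "\<exists>\<C> V. \<C> \<subseteq> rcosets\<^bsub>power_group G k\<^esub> (\<Pi>\<^sub>E i\<in>{1..k}. N) \<and>
      negligible_by_finite_quotients (power_group G k) V \<and>
      solutions G k \<phi> = \<Union>\<C> \<union> V"
proof -
  let ?P = "power_group G k" and ?N = "\<Pi>\<^sub>E i\<in>{1..k}. N"
  interpret G: group G by fact
  interpret P: group ?P by simp
  have normal: "?N \<lhd> ?P" by (rule G.power_group_normal[OF assms(4)])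
  have index: "finite_index ?N ?P" by (rule G.power_group_finite_index[OF assms(5)])
  have sub: "subgroup ?N ?P" by (rule normal_imp_subgroup[OF normal])
  obtain w where w: "w \<in> words G k" "\<phi> = word_eq G k `` {w}"
    using assms(8) by (rule G.equation_group_cases)
  have "w \<in> \<phi>" using w word_eq.refl[of w G k] by blast
  then have solutions: "solutions G k \<phi> = {g \<in> carrier ?P. word_value G (\<lambda>a. a) g w = \<one>\<^bsub>G\<^esub>}"
    using equation_value_eq[OF assms(1,8)] unfolding solutions_def by auto
  let ?sol = "solutions G k \<phi>"
  \<comment> \<open>All cosets that consist of solutions are taken, so \<open>V\<close> meets only
    cosets on which the equation fails somewhere. That failure is what provides a nonzero polynomial
    for each representative in \<open>B\<close>.\<close>
  define \<C> where "\<C> = {C \<in> rcosets\<^bsub>?P\<^esub> ?N. C \<subseteq> ?sol}"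
  define V where "V = ?sol - \<Union>\<C>"
  define r where "r C = (SOME c. c \<in> C)" for C :: "(nat \<Rightarrow> 'a) set"
  define B where "B = r ` (rcosets\<^bsub>?P\<^esub> ?N - \<C>)"
  have r: "r C \<in> carrier ?P" "C = ?N #>\<^bsub>?P\<^esub> r C" if C: "C \<in> rcosets\<^bsub>?P\<^esub> ?N" for C
  proof -
    obtain x where x: "x \<in> carrier ?P" "C = ?N #>\<^bsub>?P\<^esub> x" using C unfolding RCOSETS_def by blast
    have rC: "r C \<in> C" unfolding r_def by (rule someI[of _ x]) (use x P.rcos_self[OF x(1) sub] in simp)
    then show "r C \<in> carrier ?P"
      using subgroup.rcosets_carrier[OF sub P.group_axioms C] by blast
    show "C = ?N #>\<^bsub>?P\<^esub> r C" using P.repr_independence[OF _ x(1) sub] rC x(2) by metis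
  qed
  have finB: "finite B" using index by (simp add: B_def finite_index_def)
  have BP: "B \<subseteq> carrier ?P" using r(1) unfolding B_def by blast
  have "\<forall>c\<in>B. \<exists>m Q z. group.int_poly (?P\<lparr>carrier := ?N\<rparr>) 0 m Q \<and> z \<in> ?N \<and> Q z \<noteq> 0 \<and>
    (\<forall>x\<in>?N. x \<otimes>\<^bsub>?P\<^esub> c \<in> ?sol \<longrightarrow> Q x = 0)"
  proof
    fix c assume "c \<in> B"
    then obtain C where C: "C \<in> rcosets\<^bsub>?P\<^esub> ?N" "\<not> C \<subseteq> ?sol" "c = r C"
      unfolding B_def \<C>_def by blast
    have c: "c \<in> carrier ?P" using r(1)[OF C(1)] C(3) by simp
    obtain g where g: "g \<in> C" "g \<notin> ?sol" using C(2) by blast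
    then have "g \<in> ?N #>\<^bsub>?P\<^esub> c" using r(2)[OF C(1)] C(3) by simp
    then obtain x where x: "x \<in> ?N" "g = x \<otimes>\<^bsub>?P\<^esub> c" unfolding r_coset_def by blast
    have closed: "x \<otimes>\<^bsub>?P\<^esub> c \<in> carrier ?P" if "x \<in> ?N" for x
      using subgroup.mem_carrier[OF sub that] c by (rule P.m_closed)
    have "word_value G (\<lambda>a. a) (x \<otimes>\<^bsub>?P\<^esub> c) w \<noteq> \<one>\<^bsub>G\<^esub>"
      using g(2) closed[OF x(1)] x(2) unfolding solutions by blast
    then have "\<exists>x\<in>carrier (?P\<lparr>carrier := ?N\<rparr>). word_value G (\<lambda>a. a) (x \<otimes>\<^bsub>?P\<^esub> c) w \<noteq> \<one>\<^bsub>G\<^esub>"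
      using x(1) by (auto simp del: mult_product_group)
    from G.word_solutions_polynomial[OF assms(2,4-7) HOL.refl w(1) c this]
    obtain m Q where Q: "group.int_poly (?P\<lparr>carrier := ?N\<rparr>) 0 m Q"
      "\<exists>x\<in>carrier (?P\<lparr>carrier := ?N\<rparr>). Q x \<noteq> 0"
      "\<forall>x\<in>carrier (?P\<lparr>carrier := ?N\<rparr>). word_value G (\<lambda>a. a) (x \<otimes>\<^bsub>?P\<^esub> c) w = \<one>\<^bsub>G\<^esub> \<longrightarrow> Q x = 0"
      by blast
    obtain z where "z \<in> ?N" "Q z \<noteq> 0" using Q(2) by auto
    moreover have "\<forall>x\<in>?N. x \<otimes>\<^bsub>?P\<^esub> c \<in> ?sol \<longrightarrow> Q x = 0"
      using Q(3) by (simp add: solutions del: mult_product_group)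
    ultimately show "\<exists>m Q z. group.int_poly (?P\<lparr>carrier := ?N\<rparr>) 0 m Q \<and> z \<in> ?N \<and> Q z \<noteq> 0 \<and>
      (\<forall>x\<in>?N. x \<otimes>\<^bsub>?P\<^esub> c \<in> ?sol \<longrightarrow> Q x = 0)" using Q(1) by blast
  qed
  then obtain m Q z where Q: "\<And>c. c \<in> B \<Longrightarrow> group.int_poly (?P\<lparr>carrier := ?N\<rparr>) 0 (m c) (Q c)"
    "\<And>c. c \<in> B \<Longrightarrow> z c \<in> ?N \<and> Q c (z c) \<noteq> 0"
    "\<And>c x. c \<in> B \<Longrightarrow> x \<in> ?N \<Longrightarrow> x \<otimes>\<^bsub>?P\<^esub> c \<in> ?sol \<Longrightarrow> Q c x = 0"
    by metis
  have "negligible_by_finite_quotients ?P V"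
  proof (rule P.negligible_zero_set[OF normal index G.finitely_generated_power_group[OF assms(2)] finB BP Q(1,2)])
    fix v assume v: "v \<in> V"
    then have vP: "v \<in> carrier ?P" by (simp add: V_def solutions)
    let ?C = "?N #>\<^bsub>?P\<^esub> v"
    have C: "?C \<in> rcosets\<^bsub>?P\<^esub> ?N" using vP unfolding RCOSETS_def by blast
    have vC: "v \<in> ?C" by (rule P.rcos_self[OF vP sub])
    then have "?C \<notin> \<C>" using v unfolding V_def by blast
    then have c: "r ?C \<in> B" using C unfolding B_def by blast
    have "v \<in> ?N #>\<^bsub>?P\<^esub> r ?C" using vC r(2)[OF C] by simp
    then obtain x where x: "x \<in> ?N" "v = x \<otimes>\<^bsub>?P\<^esub> r ?C" unfolding r_coset_def by blast
    moreover have "x \<otimes>\<^bsub>?P\<^esub> r ?C \<in> ?sol" using v x(2) unfolding V_def by auto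
    ultimately show "\<exists>c\<in>B. \<exists>x\<in>?N. v = x \<otimes>\<^bsub>?P\<^esub> c \<and> Q c x = 0" using c Q(3) by blast
  qed
  moreover have "?sol = \<Union>\<C> \<union> V" unfolding V_def \<C>_def by blast
  moreover have "\<C> \<subseteq> rcosets\<^bsub>?P\<^esub> ?N" unfolding \<C>_def by blast
  ultimately show ?thesis by blast
qed

end
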